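(* Let $\alpha>1$. Then for $\mu_\alpha$-almost every $\phi$, $$\lim_{t\to0}e^{it\Delta_g}\phi(x)=\phi(x)\qquad\text{for a.e. } x\in\mathbb{S}^2.$$
   Context: $\mathbb{S}^2$ is the unit two-sphere with its standard round metric $g$, with area normalized to be $1$; $\Delta_g\le0$ is its Laplace-Beltrami operator. For $n\in\{0,1,2,\dots\}$ let $\lambda_n=\sqrt{n^2+n+1}$, let $E_n$ be the space of spherical harmonics of degree $n$ (the eigenspace of $-\Delta_g+1$ for the eigenvalue $\lambda_n^2$, of dimension $2n+1$), let $\pi_n$ be the $L^2$-orthogonal projection onto $E_n$, and let $(\mathbf{b}_{n,k})_{|k|\le n}$ be an orthonormal basis of $E_n$. Let $(g_{n,k}^\omega)_{n\ge0,|k|\le n}$ be i.i.d. standard complex Gaussian random variables on a probability space $(\Omega,\mathcal{F},\mathbb{P})$. The measure $\mu_\alpha$ is the law of the random series $$\phi_\alpha^\omega(x)=\sum_{n=0}^\infty\frac1{\lambda_n^{\alpha}}\sum_{|k|\le n}g_{n,k}^\omega\,\mathbf{b}_{n,k}(x).$$ It is the Gaussian measure with covariance operator $(-\Delta_g+1)^{-\alpha}$ and does not depend on the choice of the orthonormal bases; the space $H^{(\alpha-1)-}(\mathbb{S}^2):=\bigcap_{s<\alpha-1}H^s(\mathbb{S}^2)$ has full $\mu_\alpha$-measure. The linear Schr\"odinger flow is $e^{it\Delta_g}\phi=\sum_{n\ge0}e^{-itn(n+1)}\pi_n\phi$. Pointwise values $e^{it\Delta_g}\phi(x)$ and $\phi(x)$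 are understood as limits, along dyadic $N\to\infty$, of the smooth spectral truncations $\sum_{n\le N}e^{-itn(n+1)}\pi_n\phi(x)$ (with $t=0$ for $\phi(x)$). *)

theory Defs
  imports "HOL-Probability.Probability"
begin

text \<open>
  Functions on the unit sphere are represented by functions on \<^typ>\<open>real^3\<close> that vanish off
  the sphere, so that equality of functions on the sphere is equality in HOL.
\<close>

definition S2 :: "(real^3) set" where
  "S2 = sphere 0 1"

text \<open>
  Normalised area: the area of a Borel set of the sphere is the proportion of the unit ball filled
  by the cone over it.
\<close>

definition area :: "(real^3) measure" where
  "area = restrict_space (distr (uniform_measure lborel (ball 0 1)) borel sgn) S2"

lemma prob_space_area: "prob_space area"
proof -
  let ?U = "uniform_measure lborel (ball 0 1 :: (real^3) set)"
  have pos: "emeasure lborel (ball 0 1 :: (real^3) set) > 0"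
    by (metis emeasure_lborel_ball_finite emeasure_eq_ennreal_measure content_ball_pos
        ennreal_less_zero_iff infinity_ennreal_def less_irrefl zero_less_one)
  interpret U: prob_space ?U
    using pos emeasure_lborel_ball_finite[of "0::real^3" 1]
    by (intro prob_space_uniform_measure) auto
  have m: "(sgn :: real^3 \<Rightarrow> real^3) \<in> borel_measurable ?U"
    unfolding sgn_div_norm[abs_def] by measurable
  interpret D: prob_space "distr ?U borel sgn"
    by (rule U.prob_space_distr[OF m])
  have "AE y in lborel. (y::real^3) \<noteq> 0"
    by (rule AE_lborel_singleton)
  then have "AE y in lborel. y \<in> ball 0 1 \<longrightarrow> sgn y \<in> S2"
    by eventually_elim (simp add: S2_def norm_sgn)
  then have "AE y in ?U. sgn y \<in> S2"
    by (intro AE_uniform_measureI) auto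
  then have "AE y in distr ?U borel sgn. y \<in> S2"
    by (subst AE_distr_iff[OF m]) (auto simp: S2_def)
  then have "emeasure (distr ?U borel sgn) S2 = 1"
    by (intro D.emeasure_eq_1_AE) (auto simp: S2_def)
  then show ?thesis
    unfolding area_def
    by (intro prob_spaceI)
       (simp add: space_restrict_space emeasure_restrict_space S2_def)
qed

definition L2_inner :: "(real^3 \<Rightarrow> complex) \<Rightarrow> (real^3 \<Rightarrow> complex) \<Rightarrow> complex" where
  "L2_inner f h = (\<integral>x. f x * cnj (h x) \<partial>area)"


primrec Ck_on :: "nat \<Rightarrow> (real^3) set \<Rightarrow> (real^3 \<Rightarrow> complex) \<Rightarrow> bool" where
  "Ck_on 0 U F \<longleftrightarrow> continuous_on U F"
| "Ck_on (Suc k) U F \<longleftrightarrow>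
     (\<forall>x\<in>U. F differentiable (at x)) \<and> (\<forall>v. Ck_on k U (\<lambda>x. frechet_derivative F (at x) v))"

definition extend0 :: "(real^3 \<Rightarrow> complex) \<Rightarrow> real^3 \<Rightarrow> complex"
  \<comment> \<open>for \<open>y \<noteq> 0\<close> this is \<open>f (y / norm y)\<close>, the extension that is homogeneous of degree 0\<close>
  where "extend0 f y = f (sgn y)"

definition smooth_S2 :: "(real^3 \<Rightarrow> complex) set" where
  "smooth_S2 = {f. (\<forall>x. x \<notin> S2 \<longrightarrow> f x = 0) \<and> (\<forall>k. Ck_on k (- {0}) (extend0 f))}"

definition laplacian :: "(real^3 \<Rightarrow> complex) \<Rightarrow> real^3 \<Rightarrow> complex" where
  "laplacian F x =
     (\<Sum>e\<in>Basis. frechet_derivative (\<lambda>y. frechet_derivative F (at y) e) (at x) e)"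

text \<open>
  The Laplace-Beltrami operator of the round metric of radius 1 is the Euclidean Laplacian of the
  extension that is constant along rays, evaluated on the sphere.
\<close>

definition laplace_beltrami :: "(real^3 \<Rightarrow> complex) \<Rightarrow> real^3 \<Rightarrow> complex" where
  "laplace_beltrami f x = (if x \<in> S2 then laplacian (extend0 f) x else 0)"

definition freq :: "nat \<Rightarrow> real" where
  "freq n = sqrt (real n ^ 2 + real n + 1)"

definition harmonics :: "nat \<Rightarrow> (real^3 \<Rightarrow> complex) set" where
  "harmonics n =
     {f \<in> smooth_S2. \<forall>x. - laplace_beltrami f x + f x = complex_of_real (freq n ^ 2) * f x}"

definition orthonormal_basis ::
    "'i set \<Rightarrow> ('i \<Rightarrow> real^3 \<Rightarrow> complex) \<Rightarrow> (real^3 \<Rightarrow> complex) set \<Rightarrow> bool" where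
  "orthonormal_basis I e V \<longleftrightarrow>
     finite I \<and> (\<forall>i\<in>I. e i \<in> V) \<and>
     (\<forall>i\<in>I. \<forall>j\<in>I. L2_inner (e i) (e j) = (if i = j then 1 else 0)) \<and>
     (\<forall>f\<in>V. \<exists>c. f = (\<lambda>x. \<Sum>i\<in>I. c i * e i x))"


text \<open>
  Distributions on the sphere are tested against finite sums of spherical harmonics.  A distribution
  is determined by these values, and every Sobolev space \<open>H\<^sup>s\<close> on the sphere is the set of those
  linear functionals \<open>\<phi>\<close> on \<open>test_functions\<close> for which \<open>\<Sum>n. freq n powr (2 * s) * \<parallel>\<pi>\<^sub>n \<phi>\<parallel>\<^sup>2\<close>
  is finite, where \<open>\<pi>\<^sub>n \<phi>\<close> is \<open>harmonic_proj n \<phi>\<close> below.  A function \<open>f\<close> is identified with the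
  functional \<open>\<psi> \<mapsto> \<integral> f \<psi>\<close>, which involves no conjugation.

  The space of functionals carries the \<open>\<sigma>\<close>-algebra generated by the evaluations \<open>\<phi> \<mapsto> \<phi> \<psi>\<close>.  It is
  restricted to linear functionals because linearity is not a measurable condition for the product
  \<open>\<sigma>\<close>-algebra over the uncountable index set \<open>test_functions\<close>.
\<close>

definition test_functions :: "(real^3 \<Rightarrow> complex) set" where
  "test_functions = {\<psi>. \<exists>N f. (\<forall>n. f n \<in> harmonics n) \<and> \<psi> = (\<lambda>x. \<Sum>n\<le>N. f n x)}"

definition linear_functional :: "((real^3 \<Rightarrow> complex) \<Rightarrow> complex) \<Rightarrow> bool" where
  "linear_functional \<phi> \<longleftrightarrow>
     (\<forall>\<psi>\<in>test_functions. \<forall>\<eta>\<in>test_functions. \<phi> (\<lambda>x. \<psi> x + \<eta> x) = \<phi> \<psi> + \<phi> \<eta>) \<and>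
     (\<forall>c. \<forall>\<psi>\<in>test_functions. \<phi> (\<lambda>x. c * \<psi> x) = c * \<phi> \<psi>)"

definition distributions_S2 :: "((real^3 \<Rightarrow> complex) \<Rightarrow> complex) measure" where
  "distributions_S2 =
     restrict_space (PiM test_functions (\<lambda>_. borel)) {\<phi>. linear_functional \<phi>}"

text \<open>
  The \<open>L\<^sup>2\<close>-orthogonal projection onto \<open>harmonics n\<close>, extended to distributions: the \<open>L\<^sup>2\<close> pairing of
  \<open>\<phi>\<close> with \<open>e\<close> is \<open>\<phi>\<close> evaluated at the complex conjugate of \<open>e\<close>.
\<close>

definition harmonic_proj ::
    "nat \<Rightarrow> ((real^3 \<Rightarrow> complex) \<Rightarrow> complex) \<Rightarrow> real^3 \<Rightarrow> complex" where
  "harmonic_proj n \<phi> =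
     (THE f. f \<in> harmonics n \<and> (\<forall>e\<in>harmonics n. L2_inner f e = \<phi> (\<lambda>x. cnj (e x))))"


text \<open>
  The standard complex Gaussian has independent real and imaginary parts of variance \<open>1/2\<close>, so that
  its second absolute moment is 1.  (The last argument of \<^const>\<open>normal_density\<close> before the point is
  the standard deviation.)
\<close>

definition std_complex_gaussian :: "complex measure" where
  "std_complex_gaussian =
     distr (density lborel (normal_density 0 (1 / sqrt 2)) \<Otimes>\<^sub>M
            density lborel (normal_density 0 (1 / sqrt 2)))
       borel (\<lambda>(u, v). Complex u v)"

definition iid_std_complex_gaussian ::
    "'w measure \<Rightarrow> 'i set \<Rightarrow> ('i \<Rightarrow> 'w \<Rightarrow> complex) \<Rightarrow> bool" where
  "iid_std_complex_gaussian P I X \<longleftrightarrow>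
     prob_space.indep_vars P (\<lambda>_. borel) X I \<and>
     (\<forall>i\<in>I. distr P borel (X i) = std_complex_gaussian)"

definition degree_orders :: "nat \<Rightarrow> int set" where
  "degree_orders n = {k. \<bar>k\<bar> \<le> int n}"

text \<open>
  The random series, summed in the sense of distributions.  Against a fixed test function only
  finitely many terms are nonzero.
\<close>

definition random_series ::
    "real \<Rightarrow> (nat \<Rightarrow> int \<Rightarrow> real^3 \<Rightarrow> complex) \<Rightarrow> (nat \<Rightarrow> int \<Rightarrow> 'w \<Rightarrow> complex) \<Rightarrow>
     'w \<Rightarrow> (real^3 \<Rightarrow> complex) \<Rightarrow> complex" where
  "random_series \<alpha> b g \<omega> =
     (\<lambda>\<psi>\<in>test_functions. \<Sum>n. complex_of_real (1 / freq n powr \<alpha>) *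
        (\<Sum>k\<in>degree_orders n. g n k \<omega> * (\<integral>x. b n k x * \<psi> x \<partial>area)))"

definition gaussian_law ::
    "real \<Rightarrow> (nat \<Rightarrow> int \<Rightarrow> real^3 \<Rightarrow> complex) \<Rightarrow> 'w measure \<Rightarrow>
     (nat \<Rightarrow> int \<Rightarrow> 'w \<Rightarrow> complex) \<Rightarrow> ((real^3 \<Rightarrow> complex) \<Rightarrow> complex) measure" where
  "gaussian_law \<alpha> b P g = distr P distributions_S2 (random_series \<alpha> b g)"


definition schrodinger_trunc ::
    "nat \<Rightarrow> real \<Rightarrow> ((real^3 \<Rightarrow> complex) \<Rightarrow> complex) \<Rightarrow> real^3 \<Rightarrow> complex" where
  "schrodinger_trunc N t \<phi> x =
     (\<Sum>n\<le>N. exp (- (\<i> * complex_of_real (t * (real n * (real n + 1))))) * harmonic_proj n \<phi> x)"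

text \<open>
  Pointwise values are limits of truncations along dyadic \<open>N\<close>.  At points where the limit does not
  exist, \<open>schrodinger\<close> is an unspecified number, so the existence of the limit has to be stated
  separately.  The value \<open>\<phi>(x)\<close> is \<open>schrodinger 0 \<phi> x\<close>.
\<close>

definition schrodinger_defined ::
    "real \<Rightarrow> ((real^3 \<Rightarrow> complex) \<Rightarrow> complex) \<Rightarrow> real^3 \<Rightarrow> bool" where
  "schrodinger_defined t \<phi> x \<longleftrightarrow> convergent (\<lambda>j. schrodinger_trunc (2 ^ j) t \<phi> x)"

definition schrodinger ::
    "real \<Rightarrow> ((real^3 \<Rightarrow> complex) \<Rightarrow> complex) \<Rightarrow> real^3 \<Rightarrow> complex" where
  "schrodinger t \<phi> x = lim (\<lambda>j. schrodinger_trunc (2 ^ j) t \<phi> x)"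

end

theory Submission
  imports Defs
begin

text \<open>
Fix a point \<open>x\<close> of the sphere. There the flow is the random Fourier series
\<open>\<Sum>n. exp (- i t n (n + 1)) a\<^sub>n\<close> in time, whose coefficients \<open>a\<^sub>n = freq n powr (-\<alpha>) * (\<Sum>k. g n k * b n k x)\<close>
are independent centred Gaussians. Let \<open>V j x\<close> be the total variance of the coefficients with
\<open>2^j < n \<le> 2^(j+1)\<close>. Since the functions \<open>b n k\<close> are normalised and degree \<open>n\<close> has \<open>2n+1\<close> of them,
the mean of \<open>V j\<close> over the sphere is at most \<open>5 q^(4j)\<close> with \<open>q = 2 powr ((1-\<alpha>)/2) < 1\<close>; this is
where \<open>\<alpha> > 1\<close> enters. Hence for almost every \<open>x\<close> there is a \<open>C\<close> with \<open>V j x \<le> C q^(2j)\<close> for all \<open>j\<close>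
(\<open>AE_block_variance_bound\<close>).

A Gaussian block of standard deviation of order \<open>q^j\<close> that is a trigonometric polynomial of degree about \<open>4^j\<close>
exceeds \<open>q^j\<close> by no more than a factor of order \<open>j\<close>, uniformly for \<open>\<bar>t\<bar> \<le> 2^j\<close>: exponential moments
control the block on a time grid of exponential size in \<open>j\<close>, and a crude Lipschitz bound fills the
gaps. All the information about the coefficients that is needed for this is the finiteness of one
series of nonnegative terms, \<open>\<Sum>j. block_gauge q a j\<close>. It is finite almost surely
(\<open>AE_block_gauge_finite\<close>), and if it is finite then the dyadic partial sums converge at every time, and
locally uniformly, so that the limit is continuous in \<open>t\<close> (\<open>dyadic_limit_continuous_at_0\<close>). Since the
series is jointly measurable in the distribution and the point, Fubini's theorem exchanges "for almost
every \<open>x\<close>, almost surely" with "almost surely, for almost every \<open>x\<close>".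

To see the coefficients \<open>a\<^sub>n\<close> in the distribution \<open>random_series \<alpha> b g \<omega>\<close> one has to know that harmonics
of different degree are orthogonal (\<open>harmonics_orthogonal\<close>): only then does pairing the series with the
conjugate of \<open>b n k\<close> isolate one Gaussian, and only then is the series finite on test functions and
therefore linear. Orthogonality is the self-adjointness of the Laplace-Beltrami operator. It is obtained
in Euclidean space: for the extensions \<open>F\<close>, \<open>H\<close> that are constant along rays, the field
\<open>\<rho>(\<bar>y\<bar>\<^sup>2) (H \<nabla>F - F \<nabla>H)\<close> with a radial cutoff \<open>\<rho>\<close> has a divergence of integral 0, and the
derivative of the cutoff does not contribute because the field is tangential.
\<close>

section \<open>Smooth functions and spherical harmonics\<close>

text \<open>
The total function \<^const>\<open>frechet_derivative\<close> only depends on the germ. This permits rewriting the inner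
derivative of an iterated one on an open set only.
\<close>

lemma frechet_derivative_cong_open:
  assumes "open U" "x \<in> U" "\<And>y. y \<in> U \<Longrightarrow> F y = G y"
  shows "frechet_derivative F (at x) = frechet_derivative G (at x)"
proof -
  have "(F has_derivative D) (at x) \<longleftrightarrow> (G has_derivative D) (at x)" for D
    using assms has_derivative_transform_within_open[of F D x UNIV U G]
      has_derivative_transform_within_open[of G D x UNIV U F] by auto
  then show ?thesis
    by (simp add: frechet_derivative_def)
qed

lemma Ck_on_cong:
  assumes "open U" "\<And>y. y \<in> U \<Longrightarrow> F y = G y" "Ck_on k U F"
  shows "Ck_on k U G"
  using assms(2,3)
proof (induction k arbitrary: F G)
  case 0
  then show ?case by (simp cong: continuous_on_cong)
next
  case (Suc k)
  have "G differentiable (at x)" if "x \<in> U" for x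
  proof -
    have "F differentiable (at x)" using Suc.prems that by simp
    then show ?thesis
      unfolding differentiable_def
      using has_derivative_transform_within_open[OF _ assms(1) that] Suc.prems(1) by blast
  qed
  moreover have "Ck_on k U (\<lambda>x. frechet_derivative G (at x) v)" for v
  proof (rule Suc.IH)
    show "Ck_on k U (\<lambda>x. frechet_derivative F (at x) v)"
      using Suc.prems by simp
    show "frechet_derivative F (at y) v = frechet_derivative G (at y) v" if "y \<in> U" for y
      using frechet_derivative_cong_open[OF assms(1) that, of F G] Suc.prems(1) by auto
  qed
  ultimately show ?case by simp
qed

lemma frechet_derivative_bounded_linear:
  assumes "bounded_linear L" "F differentiable (at x)"
  shows "frechet_derivative (\<lambda>y. L (F y)) (at x) v = L (frechet_derivative F (at x) v)"
proof -
  have "((\<lambda>y. L (F y)) has_derivative (\<lambda>v. L (frechet_derivative F (at x) v))) (at x)"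
    using bounded_linear.has_derivative[OF assms(1)] assms(2) frechet_derivative_works by blast
  from frechet_derivative_at[OF this] show ?thesis by metis
qed

lemma frechet_derivative_plus:
  assumes "F differentiable (at x)" "G differentiable (at x)"
  shows "frechet_derivative (\<lambda>y. F y + G y) (at x) v =
    frechet_derivative F (at x) v + frechet_derivative G (at x) v"
proof -
  have "((\<lambda>y. F y + G y) has_derivative
      (\<lambda>v. frechet_derivative F (at x) v + frechet_derivative G (at x) v)) (at x)"
    using assms by (intro has_derivative_add) (auto simp: frechet_derivative_works[symmetric])
  from frechet_derivative_at[OF this] show ?thesis by metis
qed

lemma Ck_on_bounded_linear:
  assumes "open U" "bounded_linear L" "Ck_on k U F"
  shows "Ck_on k U (\<lambda>x. L (F x))"
  using assms(3)
proof (induction k arbitrary: F)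
  case 0
  then show ?case
    using bounded_linear.continuous_on[OF assms(2), of U F] by simp
next
  case (Suc k)
  have "(\<lambda>x. L (F x)) differentiable (at x)" if "x \<in> U" for x
  proof -
    have "F differentiable (at x)"
      using Suc.prems that by simp
    then have "(F has_derivative frechet_derivative F (at x)) (at x)"
      by (simp only: frechet_derivative_works)
    from bounded_linear.has_derivative[OF assms(2) this] show ?thesis
      by (auto simp: differentiable_def)
  qed
  moreover have "Ck_on k U (\<lambda>x. frechet_derivative (\<lambda>x. L (F x)) (at x) v)" for v
  proof (rule Ck_on_cong[OF assms(1)])
    show "Ck_on k U (\<lambda>x. L (frechet_derivative F (at x) v))"
      using Suc.prems by (intro Suc.IH) simp
  qed (use Suc.prems in \<open>simp add: frechet_derivative_bounded_linear[OF assms(2)]\<close>)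
  ultimately show ?case by simp
qed

lemma Ck_on_add:
  assumes "open U" "Ck_on k U F" "Ck_on k U G"
  shows "Ck_on k U (\<lambda>x. F x + G x)"
  using assms(2,3)
proof (induction k arbitrary: F G)
  case 0
  then show ?case by (auto intro: continuous_on_add)
next
  case (Suc k)
  have "Ck_on k U (\<lambda>x. frechet_derivative (\<lambda>x. F x + G x) (at x) v)" for v
  proof (rule Ck_on_cong[OF assms(1)])
    show "Ck_on k U (\<lambda>x. frechet_derivative F (at x) v + frechet_derivative G (at x) v)"
      using Suc.prems by (intro Suc.IH) simp_all
  qed (use Suc.prems in \<open>simp add: frechet_derivative_plus\<close>)
  with Suc.prems show ?case by simp
qed

lemma laplacian_bounded_linear:
  assumes "open U" "bounded_linear L" "Ck_on 2 U F" "x \<in> U"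
  shows "laplacian (\<lambda>y. L (F y)) x = L (laplacian F x)"
proof -
  interpret bounded_linear L by fact
  have 1: "frechet_derivative (\<lambda>y. frechet_derivative (\<lambda>y. L (F y)) (at y) e) (at x) e =
      L (frechet_derivative (\<lambda>y. frechet_derivative F (at y) e) (at x) e)" for e
  proof -
    have "frechet_derivative (\<lambda>y. frechet_derivative (\<lambda>y. L (F y)) (at y) e) (at x) =
        frechet_derivative (\<lambda>y. L (frechet_derivative F (at y) e)) (at x)"
      using assms by (intro frechet_derivative_cong_open[OF assms(1,4)])
        (auto simp: numeral_2_eq_2 frechet_derivative_bounded_linear[OF assms(2)])
    then show ?thesis
      using assms by (simp add: numeral_2_eq_2 frechet_derivative_bounded_linear[OF assms(2)])
  qed
  show ?thesis
    unfolding laplacian_def 1 sum ..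
qed

lemma laplacian_plus:
  assumes "open U" "Ck_on 2 U F" "Ck_on 2 U G" "x \<in> U"
  shows "laplacian (\<lambda>y. F y + G y) x = laplacian F x + laplacian G x"
proof -
  have 1: "frechet_derivative (\<lambda>y. frechet_derivative (\<lambda>y. F y + G y) (at y) e) (at x) e =
      frechet_derivative (\<lambda>y. frechet_derivative F (at y) e) (at x) e +
      frechet_derivative (\<lambda>y. frechet_derivative G (at y) e) (at x) e" for e
  proof -
    have "frechet_derivative (\<lambda>y. frechet_derivative (\<lambda>y. F y + G y) (at y) e) (at x) =
        frechet_derivative (\<lambda>y. frechet_derivative F (at y) e + frechet_derivative G (at y) e) (at x)"
      using assms by (intro frechet_derivative_cong_open[OF assms(1,4)])
        (auto simp: numeral_2_eq_2 frechet_derivative_plus)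
    then show ?thesis
      using assms by (simp add: numeral_2_eq_2 frechet_derivative_plus)
  qed
  show ?thesis
    unfolding laplacian_def 1 sum.distrib ..
qed

lemma S2_nonzero: "x \<in> S2 \<Longrightarrow> x \<in> - {0}" "x \<in> S2 \<Longrightarrow> sgn x = x"
  by (auto simp: S2_def sgn_div_norm)

lemma smooth_S2_bounded_linear:
  assumes "bounded_linear L" "f \<in> smooth_S2"
  shows "(\<lambda>x. L (f x)) \<in> smooth_S2"
    and "x \<in> S2 \<Longrightarrow> laplace_beltrami (\<lambda>x. L (f x)) x = L (laplace_beltrami f x)"
proof -
  interpret bounded_linear L by fact
  have e: "extend0 (\<lambda>x. L (f x)) = (\<lambda>y. L (extend0 f y))"
    by (simp add: extend0_def fun_eq_iff)
  have C: "Ck_on k (- {0}) (extend0 f)" for k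
    using assms by (auto simp: smooth_S2_def)
  show "(\<lambda>x. L (f x)) \<in> smooth_S2"
    using assms(2) Ck_on_bounded_linear[OF _ assms(1) C]
    by (auto simp: smooth_S2_def e zero)
  show "laplace_beltrami (\<lambda>x. L (f x)) x = L (laplace_beltrami f x)" if "x \<in> S2"
    using that laplacian_bounded_linear[OF _ assms(1) C, of x] S2_nonzero(1)[OF that]
    by (auto simp: laplace_beltrami_def e)
qed

lemma smooth_S2_add:
  assumes "f \<in> smooth_S2" "h \<in> smooth_S2"
  shows "(\<lambda>x. f x + h x) \<in> smooth_S2"
    and "x \<in> S2 \<Longrightarrow> laplace_beltrami (\<lambda>x. f x + h x) x = laplace_beltrami f x + laplace_beltrami h x"
proof -
  have e: "extend0 (\<lambda>x. f x + h x) = (\<lambda>y. extend0 f y + extend0 h y)"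
    by (simp add: extend0_def fun_eq_iff)
  have C: "Ck_on k (- {0}) (extend0 f)" "Ck_on k (- {0}) (extend0 h)" for k
    using assms by (auto simp: smooth_S2_def)
  show "(\<lambda>x. f x + h x) \<in> smooth_S2"
    using assms Ck_on_add[OF _ C] by (auto simp: smooth_S2_def e)
  show "laplace_beltrami (\<lambda>x. f x + h x) x = laplace_beltrami f x + laplace_beltrami h x" if "x \<in> S2"
    using that laplacian_plus[OF _ C, of x] S2_nonzero(1)[OF that]
    by (auto simp: laplace_beltrami_def e)
qed

text \<open>
Off the sphere both sides of the eigenvalue equation vanish, and the shift by 1 in \<^const>\<open>freq\<close> cancels.
\<close>

lemma harmonics_iff:
  "f \<in> harmonics n \<longleftrightarrow> f \<in> smooth_S2 \<and>
     (\<forall>x\<in>S2. laplace_beltrami f x = - of_nat (n * (n + 1)) * f x)"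
proof -
  have fr: "(freq n)\<^sup>2 = real (n * (n + 1)) + 1"
  proof -
    have "(freq n)\<^sup>2 = real n ^ 2 + real n + 1"
      unfolding freq_def by (rule real_sqrt_pow2) simp
    then show ?thesis
      by (simp add: power2_eq_square distrib_left)
  qed
  have "- laplace_beltrami f x + f x = complex_of_real (freq n ^ 2) * f x \<longleftrightarrow>
     laplace_beltrami f x = - of_nat (n * (n + 1)) * f x" for x
  proof -
    have "complex_of_real (freq n ^ 2) = of_nat (n * (n + 1)) + 1"
      unfolding fr by simp
    then have "- laplace_beltrami f x + f x = complex_of_real (freq n ^ 2) * f x \<longleftrightarrow>
      - laplace_beltrami f x + f x = (of_nat (n * (n + 1)) + 1) * f x" by simp
    also have "\<dots> \<longleftrightarrow> - laplace_beltrami f x = of_nat (n * (n + 1)) * f x"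
      by (simp add: distrib_right)
    also have "\<dots> \<longleftrightarrow> laplace_beltrami f x = - of_nat (n * (n + 1)) * f x"
      by (metis minus_mult_left minus_equation_iff)
    finally show ?thesis .
  qed
  moreover have "laplace_beltrami f x = - of_nat (n * (n + 1)) * f x"
    if "f \<in> smooth_S2" "x \<notin> S2" for x
    using that by (auto simp: laplace_beltrami_def smooth_S2_def)
  ultimately show ?thesis
    unfolding harmonics_def by auto
qed

lemma harmonics_add: "f \<in> harmonics n \<Longrightarrow> h \<in> harmonics n \<Longrightarrow> (\<lambda>x. f x + h x) \<in> harmonics n"
  by (auto simp: harmonics_iff smooth_S2_add distrib_left)

lemma harmonics_scale: "f \<in> harmonics n \<Longrightarrow> (\<lambda>x. c * f x) \<in> harmonics n"
  by (auto simp: harmonics_iff smooth_S2_bounded_linear[OF bounded_linear_mult_right])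

lemma harmonics_cnj: "f \<in> harmonics n \<Longrightarrow> (\<lambda>x. cnj (f x)) \<in> harmonics n"
  by (auto simp: harmonics_iff smooth_S2_bounded_linear[OF bounded_linear_cnj])

lemma zero_in_harmonics: "(\<lambda>x. 0) \<in> harmonics n"
proof -
  have c: "Ck_on k U (\<lambda>x. 0)" for k U
    by (induction k) auto
  show ?thesis
    by (auto simp: harmonics_iff smooth_S2_def laplace_beltrami_def extend0_def[abs_def]
        laplacian_def c)
qed

lemma harmonics_sum:
  assumes "finite I" "\<And>i. i \<in> I \<Longrightarrow> f i \<in> harmonics n"
  shows "(\<lambda>x. \<Sum>i\<in>I. c i * f i x) \<in> harmonics n"
  using assms by (induction) (auto intro!: harmonics_add harmonics_scale zero_in_harmonics)

section \<open>Orthogonality of harmonics of different degree\<close>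

lemma integrable_continuous_compact_support:
  fixes u :: "'a::euclidean_space \<Rightarrow> complex"
  assumes "continuous_on UNIV u" "\<And>y. norm y \<ge> R \<Longrightarrow> u y = 0"
  shows "integrable lborel u"
proof -
  have "integrable lborel (\<lambda>y. indicator (cball 0 R) y *\<^sub>R u y)"
    using assms(1) by (intro borel_integrable_compact) (auto intro: continuous_on_subset)
  also have "(\<lambda>y. indicator (cball 0 R) y *\<^sub>R u y) = u"
    using assms(2) by (auto simp: fun_eq_iff indicator_def)
  finally show ?thesis .
qed

text \<open>
The difference quotients of \<open>u\<close> along \<open>e\<close> have integral 0 because Lebesgue measure is invariant under
translations. They converge to the derivative, and they are dominated: the derivative bounds them
uniformly, and for increments of length at most \<open>norm e\<close> they live on a fixed ball.
\<close>

lemma integral_directional_derivative_eq_0: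
  fixes u :: "'a::euclidean_space \<Rightarrow> complex"
  assumes D: "\<And>y. (u has_derivative D y) (at y)"
    and e: "\<And>y. D y e = u' y"
    and cont: "continuous_on UNIV u'"
    and supp: "\<And>y. norm y \<ge> R \<Longrightarrow> u y = 0" "\<And>y. norm y \<ge> R \<Longrightarrow> u' y = 0"
  shows "(\<integral>y. u' y \<partial>lborel) = 0"
proof -
  have contu: "continuous_on UNIV u"
    using D by (auto intro!: continuous_at_imp_continuous_on has_derivative_continuous)
  have int: "integrable lborel u"
    using contu supp(1) by (rule integrable_continuous_compact_support)
  have "bounded (u' ` cball 0 R)"
    using cont by (intro compact_imp_bounded compact_continuous_image)
      (auto intro: continuous_on_subset)
  then obtain B0 where B0: "\<And>y. norm y \<le> R \<Longrightarrow> norm (u' y) \<le> B0"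
    unfolding bounded_iff by (metis imageI mem_cball_0)
  define B where "B = max B0 0"
  have B: "norm (u' y) \<le> B" "B \<ge> 0" for y
    using B0[of y] supp(2)[of y] by (cases "norm y \<le> R") (auto simp: B_def)
  have line: "((\<lambda>s. u (y + s *\<^sub>R e)) has_derivative (\<lambda>r. r *\<^sub>R u' (y + s *\<^sub>R e))) (at s)" for y s
  proof -
    interpret bounded_linear "D (y + s *\<^sub>R e)"
      using D has_derivative_bounded_linear by blast
    have "((\<lambda>s. u (y + s *\<^sub>R e)) has_derivative (\<lambda>r. D (y + s *\<^sub>R e) (r *\<^sub>R e))) (at s)"
      by (rule has_derivative_compose[OF _ D]) (auto intro!: derivative_eq_intros)
    then show ?thesis
      by (simp add: scaleR e)
  qed
  have lip: "norm (u (y + s *\<^sub>R e) - u y) \<le> B * \<bar>s\<bar>" for y s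
  proof -
    have "norm (u (y + s *\<^sub>R e) - u (y + 0 *\<^sub>R e)) \<le> B * norm (s - 0)"
    proof (rule differentiable_bound[where S=UNIV])
      show "((\<lambda>s. u (y + s *\<^sub>R e)) has_derivative (\<lambda>r. r *\<^sub>R u' (y + s *\<^sub>R e))) (at s within UNIV)" for s
        by (rule line)
      show "onorm (\<lambda>r. r *\<^sub>R u' (y + s *\<^sub>R e)) \<le> B" for s
        using B(1)[of "y + s *\<^sub>R e"] B(2)
        by (intro onorm_bound) (auto simp: mult.commute[of _ "\<bar>_\<bar>"] intro: mult_left_mono)
    qed auto
    then show ?thesis by simp
  qed
  define d where "d k y = real (Suc k) *\<^sub>R (u (y + (1 / real (Suc k)) *\<^sub>R e) - u y)" for k y
  have transl: "integrable lborel (\<lambda>y. u (y + c)) \<and> (\<integral>y. u (y + c) \<partial>lborel) = (\<integral>y. u y \<partial>lborel)" for c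
  proof -
    have um: "u \<in> borel_measurable borel"
      using contu by (rule borel_measurable_continuous_onI)
    have "integrable (distr lborel borel ((+) c)) u"
      using int by (simp add: lborel_distr_plus)
    then have "integrable lborel (\<lambda>y. u (c + y))"
      using um by (subst (asm) integrable_distr_eq) auto
    moreover have "(\<integral>y. u y \<partial>distr lborel borel ((+) c)) = (\<integral>y. u (c + y) \<partial>lborel)"
      using um by (intro integral_distr) auto
    ultimately show ?thesis
      by (simp add: lborel_distr_plus add.commute)
  qed
  have d0: "(\<integral>y. d k y \<partial>lborel) = 0" for k
    unfolding d_def using transl int by simp
  have "(\<lambda>k. \<integral>y. d k y \<partial>lborel) \<longlonglongrightarrow> (\<integral>y. u' y \<partial>lborel)"
  proof (rule integral_dominated_convergence[where w = "\<lambda>y. indicator (cball 0 (R + norm e)) y *\<^sub>R B"])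
    show "u' \<in> borel_measurable lborel"
      using cont by (simp add: borel_measurable_continuous_onI)
    show "d k \<in> borel_measurable lborel" for k
      unfolding d_def[abs_def] using transl int
      by (intro borel_measurable_integrable) auto
    show "integrable lborel (\<lambda>y. indicator (cball 0 (R + norm e)) y *\<^sub>R B)"
      by (intro borel_integrable_compact) auto
    show "AE y in lborel. (\<lambda>k. d k y) \<longlonglongrightarrow> u' y"
    proof (rule AE_I2)
      fix y
      have "((\<lambda>s. u (y + s *\<^sub>R e)) has_vector_derivative u' y) (at 0)"
        using line[of y 0] by (simp add: has_vector_derivative_def)
      then have "((\<lambda>h. (u (y + h *\<^sub>R e) - u y) /\<^sub>R h) \<longlongrightarrow> u' y) (at 0)"
      proof -
        assume "((\<lambda>s. u (y + s *\<^sub>R e)) has_vector_derivative u' y) (at 0)"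
        then have "((\<lambda>h. norm (u (y + h *\<^sub>R e) - u y - h *\<^sub>R u' y) / norm h) \<longlongrightarrow> 0) (at 0)"
          by (simp add: has_vector_derivative_def has_derivative_at)
        moreover have "\<forall>\<^sub>F h in at 0. norm (u (y + h *\<^sub>R e) - u y - h *\<^sub>R u' y) / norm h =
            norm ((u (y + h *\<^sub>R e) - u y) /\<^sub>R h - u' y)"
        proof (unfold eventually_at_filter, intro always_eventually allI impI)
          fix h :: real assume "h \<noteq> 0"
          then have "u (y + h *\<^sub>R e) - u y - h *\<^sub>R u' y =
              h *\<^sub>R ((u (y + h *\<^sub>R e) - u y) /\<^sub>R h - u' y)"
            by (simp add: scaleR_diff_right)
          with \<open>h \<noteq> 0\<close> show "norm (u (y + h *\<^sub>R e) - u y - h *\<^sub>R u' y) / norm h =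
            norm ((u (y + h *\<^sub>R e) - u y) /\<^sub>R h - u' y)"
            by simp
        qed
        ultimately have "((\<lambda>h. norm ((u (y + h *\<^sub>R e) - u y) /\<^sub>R h - u' y)) \<longlongrightarrow> 0) (at 0)"
          by (rule Lim_transform_eventually)
        then show ?thesis
          by (rule LIM_zero_cancel[OF tendsto_norm_zero_cancel])
      qed
      moreover have "filterlim (\<lambda>k. 1 / real (Suc k)) (at 0) sequentially"
        unfolding filterlim_at using LIMSEQ_inverse_real_of_nat by (auto simp: inverse_eq_divide)
      ultimately have "(\<lambda>k. (u (y + (1 / real (Suc k)) *\<^sub>R e) - u y) /\<^sub>R (1 / real (Suc k))) \<longlonglongrightarrow> u' y"
        by (rule filterlim_compose)
      then show "(\<lambda>k. d k y) \<longlonglongrightarrow> u' y"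
        unfolding d_def by simp
    qed
    show "AE y in lborel. norm (d k y) \<le> indicator (cball 0 (R + norm e)) y *\<^sub>R B" for k
    proof (rule AE_I2)
      fix y
      show "norm (d k y) \<le> indicator (cball 0 (R + norm e)) y *\<^sub>R B"
      proof (cases "norm y \<le> R + norm e")
        case True
        have "norm (d k y) \<le> real (Suc k) * (B * \<bar>1 / real (Suc k)\<bar>)"
          unfolding d_def norm_scaleR using lip[of y "1 / real (Suc k)"] by (intro mult_mono) auto
        then show ?thesis using True by simp
      next
        case False
        have "norm ((1 / real (Suc k)) *\<^sub>R e) \<le> norm e"
          by (simp add: divide_le_eq mult_le_cancel_left1)
        then have "norm (y + (1 / real (Suc k)) *\<^sub>R e) \<ge> R"
          using False norm_diff_ineq[of y "(1 / real (Suc k)) *\<^sub>R e"] by linarith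
        moreover have "norm y \<ge> R"
          using False norm_ge_zero[of e] by linarith
        ultimately show ?thesis
          using supp(1) False unfolding d_def by simp
      qed
    qed
  qed
  with d0 show ?thesis
    by (simp add: LIMSEQ_const_iff)
qed

text \<open>
The extensions of functions on the sphere and their derivatives are singular at the origin; a radial
factor that vanishes near the origin removes the singularity.
\<close>

lemma continuous_on_radial_cutoff:
  fixes G :: "'a::euclidean_space \<Rightarrow> complex"
  assumes "continuous_on UNIV w" "continuous_on (- {0}) G" "a > 0" "\<And>s. s \<le> a \<Longrightarrow> w s = 0"
  shows "continuous_on UNIV (\<lambda>y. w (y \<bullet> y) *\<^sub>R G y)"
proof -
  have 1: "continuous_on (- {0}) (\<lambda>y. w (y \<bullet> y) *\<^sub>R G y)"
    by (intro continuous_on_scaleR assms(2) continuous_on_compose2[OF assms(1)] continuous_intros) auto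
  have "continuous_on {y. y \<bullet> y < a} (\<lambda>y. w (y \<bullet> y) *\<^sub>R G y) \<longleftrightarrow> 
     continuous_on {y::'a. y \<bullet> y < a} (\<lambda>y. 0::complex)"
    using assms(4) by (intro continuous_on_cong) auto
  then have 2: "continuous_on {y. y \<bullet> y < a} (\<lambda>y. w (y \<bullet> y) *\<^sub>R G y)"
    by simp
  have "open {y::'a. y \<bullet> y < a}"
    by (intro open_Collect_less continuous_intros)
  with 1 2 have "continuous_on (- {0} \<union> {y. y \<bullet> y < a}) (\<lambda>y. w (y \<bullet> y) *\<^sub>R G y)"
    by (intro continuous_on_open_Un) auto
  moreover have "- {0} \<union> {y::'a. y \<bullet> y < a} = UNIV"
    using assms(3) by auto
  ultimately show ?thesis by simp
qed

lemma extend0_scale: "c > 0 \<Longrightarrow> extend0 f (c *\<^sub>R y) = extend0 f y"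
  by (simp add: extend0_def sgn_scaleR)

lemma frechet_derivative_extend0_radial:
  assumes "extend0 f differentiable (at y)" "y \<noteq> 0"
  shows "frechet_derivative (extend0 f) (at y) y = 0"
proof -
  let ?D = "frechet_derivative (extend0 f) (at y)"
  have D: "(extend0 f has_derivative ?D) (at ((1 + 0) *\<^sub>R y))"
    using assms frechet_derivative_works by auto
  have "((\<lambda>s. extend0 f ((1 + s) *\<^sub>R y)) has_derivative (\<lambda>r. ?D (r *\<^sub>R y))) (at 0)"
    by (rule has_derivative_compose[where f = "\<lambda>s. (1 + s) *\<^sub>R y" and g = "extend0 f", OF _ D])
       (auto intro!: derivative_eq_intros)
  moreover have "((\<lambda>s. extend0 f ((1 + s) *\<^sub>R y)) has_derivative (\<lambda>r. 0)) (at 0)"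
  proof (rule has_derivative_transform_within_open[where s = "{-1<..}"])
    show "((\<lambda>s::real. extend0 f y) has_derivative (\<lambda>r. 0)) (at 0)" by simp
  qed (auto simp: extend0_scale)
  ultimately have "(\<lambda>r. ?D (r *\<^sub>R y)) = (\<lambda>r. 0)"
    by (rule has_derivative_unique)
  then show ?thesis
    by (metis scaleR_one)
qed

lemma frechet_derivative_scaled:
  assumes "G differentiable (at (c *\<^sub>R y))"
  shows "frechet_derivative (\<lambda>z. G (c *\<^sub>R z)) (at y) v = c *\<^sub>R frechet_derivative G (at (c *\<^sub>R y)) v"
proof -
  let ?D = "frechet_derivative G (at (c *\<^sub>R y))"
  have D: "(G has_derivative ?D) (at (c *\<^sub>R y))"
    using assms frechet_derivative_works by auto
  interpret bounded_linear ?D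
    using D by (rule has_derivative_bounded_linear)
  have "((\<lambda>z. G (c *\<^sub>R z)) has_derivative (\<lambda>v. ?D (c *\<^sub>R v))) (at y)"
    by (rule has_derivative_compose[where f = "\<lambda>z. c *\<^sub>R z" and g = G, OF _ D])
       (auto intro!: derivative_eq_intros)
  from frechet_derivative_at[OF this, symmetric] show ?thesis
    by (simp add: scaleR)
qed

text \<open>
Each derivative of a function that is homogeneous of degree 0 lowers the degree of homogeneity by 1,
so the Laplacian is homogeneous of degree -2 and determined by its values on the sphere.
\<close>

lemma laplacian_extend0:
  assumes "f \<in> smooth_S2" "y \<noteq> 0"
  shows "laplacian (extend0 f) y = laplace_beltrami f (sgn y) /\<^sub>R (y \<bullet> y)"
proof -
  let ?F = "extend0 f"
  let ?d = "\<lambda>e y. frechet_derivative ?F (at y) e"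
  have C: "Ck_on 2 (- {0}) ?F"
    using assms(1) by (auto simp: smooth_S2_def)
  define c where "c = inverse (norm y)"
  have c: "c > 0"
    using assms(2) by (simp add: c_def)
  have F: "(\<lambda>z. ?F (c *\<^sub>R z)) = ?F"
    using c by (simp add: extend0_scale fun_eq_iff)
  have d: "?d e z = c *\<^sub>R ?d e (c *\<^sub>R z)" if "z \<noteq> 0" for z e
    using frechet_derivative_scaled[of ?F c z e] C that c by (simp add: F numeral_2_eq_2)
  have dd: "frechet_derivative (?d e) (at y) e = c\<^sup>2 *\<^sub>R frechet_derivative (?d e) (at (c *\<^sub>R y)) e" for e
  proof -
    have "frechet_derivative (?d e) (at y) = frechet_derivative (\<lambda>z. c *\<^sub>R ?d e (c *\<^sub>R z)) (at y)"
      using d assms(2) by (intro frechet_derivative_cong_open[where U = "- {0}"]) auto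
    moreover have "(\<lambda>z. ?d e (c *\<^sub>R z)) differentiable (at y)"
    proof -
      have "?d e differentiable (at (c *\<^sub>R y))"
        using C assms(2) c by (simp add: numeral_2_eq_2)
      moreover have "(\<lambda>z. c *\<^sub>R z) differentiable (at y)"
        by (intro derivative_intros)
      ultimately show ?thesis
        using differentiable_chain_at[of "\<lambda>z. c *\<^sub>R z" y "?d e"] by (simp add: o_def)
    qed
    ultimately have "frechet_derivative (?d e) (at y) e =
        c *\<^sub>R frechet_derivative (\<lambda>z. ?d e (c *\<^sub>R z)) (at y) e"
      using frechet_derivative_bounded_linear[OF bounded_linear_scaleR_right] by metis
    also have "\<dots> = c *\<^sub>R c *\<^sub>R frechet_derivative (?d e) (at (c *\<^sub>R y)) e"
      using C assms(2) c by (subst frechet_derivative_scaled) (auto simp: numeral_2_eq_2)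
    finally show ?thesis by (simp add: power2_eq_square)
  qed
  have sg: "c *\<^sub>R y = sgn y"
    by (simp add: c_def sgn_div_norm)
  have "sgn y \<in> S2"
    using assms(2) by (simp add: S2_def norm_sgn)
  then have "laplacian ?F y = c\<^sup>2 *\<^sub>R laplace_beltrami f (sgn y)"
    unfolding laplacian_def laplace_beltrami_def dd sg by (simp add: scaleR_sum_right)
  also have "c\<^sup>2 = inverse (y \<bullet> y)"
    unfolding c_def by (simp add: power2_norm_eq_inner[symmetric] power_inverse)
  finally show ?thesis .
qed

text \<open>
Green's identity for the field \<open>\<rho>(y \<bullet> y) (H \<nabla>F - F \<nabla>H)\<close>. Its divergence has the two parts \<open>v\<close> (the
Laplacians, the products of gradients cancelling) and \<open>w\<close> (the derivative of the cutoff). The second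
part is the radial component of \<open>H \<nabla>F - F \<nabla>H\<close> up to a factor, hence 0 as \<open>F\<close> and \<open>H\<close> are constant along
rays.
\<close>

lemma green_tangential:
  assumes f: "f \<in> smooth_S2" and h: "h \<in> smooth_S2"
    and \<rho>: "\<And>s. (\<rho> has_real_derivative \<rho>' s) (at s)" and cont: "continuous_on UNIV \<rho>'"
    and a: "0 < a" "\<And>s. s \<le> a \<Longrightarrow> \<rho> s = 0" "\<And>s. s \<le> a \<Longrightarrow> \<rho>' s = 0"
    and b: "\<And>s. s \<ge> b \<Longrightarrow> \<rho> s = 0" "\<And>s. s \<ge> b \<Longrightarrow> \<rho>' s = 0"
  shows "(\<integral>y. \<rho> (y \<bullet> y) *\<^sub>R (extend0 h y * laplacian (extend0 f) y
            - extend0 f y * laplacian (extend0 h) y) \<partial>lborel) = 0"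
proof -
  let ?F = "extend0 f" and ?H = "extend0 h"
  let ?dF = "\<lambda>e y. frechet_derivative ?F (at y) e" and ?dH = "\<lambda>e y. frechet_derivative ?H (at y) e"
  let ?ddF = "\<lambda>e y. frechet_derivative (?dF e) (at y) e"
  let ?ddH = "\<lambda>e y. frechet_derivative (?dH e) (at y) e"
  have CF: "Ck_on 2 (- {0}) ?F" and CH: "Ck_on 2 (- {0}) ?H"
    using f h by (auto simp: smooth_S2_def)
  have dif: "?F differentiable (at y)" "?H differentiable (at y)"
    "?dF e differentiable (at y)" "?dH e differentiable (at y)" if "y \<noteq> 0" for y e
    using CF CH that by (auto simp: numeral_2_eq_2)
  have cont1: "continuous_on (- {0}) g" if "\<And>y. y \<noteq> 0 \<Longrightarrow> g differentiable (at y)"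
    for g :: "real^3 \<Rightarrow> complex"
    using that by (auto intro!: continuous_at_imp_continuous_on differentiable_imp_continuous_within)
  have cF: "continuous_on (- {0}) ?F" "continuous_on (- {0}) ?H"
    "continuous_on (- {0}) (?dF e)" "continuous_on (- {0}) (?dH e)"
    "continuous_on (- {0}) (?ddF e)" "continuous_on (- {0}) (?ddH e)" for e
    using dif CF CH by (auto intro!: cont1 simp: numeral_2_eq_2)
  have cont\<rho>: "continuous_on UNIV \<rho>"
    using \<rho> by (intro continuous_at_imp_continuous_on ballI) (rule DERIV_isCont)
  define W where "W e y = ?H y * ?dF e y - ?F y * ?dH e y" for e y
  define u where "u e y = \<rho> (y \<bullet> y) *\<^sub>R W e y" for e y
  define v where "v e y = \<rho> (y \<bullet> y) *\<^sub>R (?H y * ?ddF e y - ?F y * ?ddH e y)" for e y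
  define w where "w e y = \<rho>' (y \<bullet> y) *\<^sub>R ((2 * (y \<bullet> e)) *\<^sub>R W e y)" for e y
  have cv: "continuous_on UNIV (v e)" for e
    unfolding v_def
    by (rule continuous_on_radial_cutoff[OF cont\<rho> _ a(1,2)]) (intro continuous_intros cF)
  have cw: "continuous_on UNIV (w e)" for e
    unfolding w_def W_def
    by (rule continuous_on_radial_cutoff[OF cont _ a(1,3)]) (intro continuous_intros cF)
  define R where "R = sqrt (max b 0)"
  have R: "y \<bullet> y \<ge> b" if "norm y \<ge> R" for y :: "real^3"
  proof -
    have "y \<bullet> y = (norm y)\<^sup>2" by (simp add: power2_norm_eq_inner)
    also have "\<dots> \<ge> R\<^sup>2" using that by (intro power_mono) (auto simp: R_def)
    finally show ?thesis by (simp add: R_def)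
  qed
  have iv: "integrable lborel (v e)" and iw: "integrable lborel (w e)" for e
    using integrable_continuous_compact_support[OF cv, of R] 
      integrable_continuous_compact_support[OF cw, of R] R b by (auto simp: v_def w_def)
  have zero: "(\<integral>y. (v e y + w e y) \<partial>lborel) = 0" for e
  proof (rule integral_directional_derivative_eq_0[where R = R and u = "u e" and e = e])
    fix y :: "real^3"
    show "u e y = 0" "v e y + w e y = 0" if "norm y \<ge> R"
      using R[OF that] b by (auto simp: u_def v_def w_def)
    (* near the origin u vanishes, and the second derivatives of the extensions are only available away from it *)
    define D where "D = (if y = 0 then (\<lambda>_. 0) else
       (\<lambda>d. \<rho> (y \<bullet> y) *\<^sub>R ((?H y * frechet_derivative (?dF e) (at y) d
           + frechet_derivative ?H (at y) d * ?dF e y)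
         - (?F y * frechet_derivative (?dH e) (at y) d + frechet_derivative ?F (at y) d * ?dH e y))
        + (\<rho>' (y \<bullet> y) * (2 * (y \<bullet> d))) *\<^sub>R W e y))"
    have "(u e has_derivative D) (at y)"
    proof (cases "y = 0")
      case True
      have "(u e has_derivative (\<lambda>_. 0)) (at y)"
      proof (rule has_derivative_transform_within_open[where s = "{y. y \<bullet> y < a}" and f = "\<lambda>_. 0"])
        show "open {y::real^3. y \<bullet> y < a}"
          by (intro open_Collect_less continuous_intros)
      qed (use True a in \<open>auto simp: u_def\<close>)
      then show ?thesis using True by (simp add: D_def)
    next
      case False
      note fw = dif[OF False, unfolded frechet_derivative_works]
      have sq: "((\<lambda>y. \<rho> (y \<bullet> y)) has_derivative (\<lambda>d. \<rho>' (y \<bullet> y) * (2 * (y \<bullet> d)))) (at y)"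
      proof -
        have "((\<lambda>y. y \<bullet> y) has_derivative (\<lambda>d. 2 * (y \<bullet> d))) (at y)"
          by (auto intro!: derivative_eq_intros simp: inner_commute)
        from has_derivative_compose[OF this \<rho>[unfolded has_field_derivative_def]]
        show ?thesis by simp
      qed
      have "(W e has_derivative (\<lambda>d. (?H y * frechet_derivative (?dF e) (at y) d
           + frechet_derivative ?H (at y) d * ?dF e y)
         - (?F y * frechet_derivative (?dH e) (at y) d + frechet_derivative ?F (at y) d * ?dH e y))) (at y)"
        unfolding W_def[abs_def] by (intro has_derivative_diff has_derivative_mult fw)
      from has_derivative_scaleR[OF sq this]
      show ?thesis
        using False unfolding u_def[abs_def] D_def by simp
    qed
    then show "(u e has_derivative D) (at y)" .
    show "D e = v e y + w e y"
      using a by (auto simp: D_def v_def w_def u_def algebra_simps)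
  next
    show "continuous_on UNIV (\<lambda>y. v e y + w e y)"
      by (intro continuous_on_add cv cw)
  qed
  have radial: "(\<Sum>e\<in>Basis. w e y) = 0" for y
  proof (cases "y = 0")
    case False
    have lin: "linear (frechet_derivative ?F (at y))" "linear (frechet_derivative ?H (at y))"
      using dif[OF False] by (auto intro: linear_frechet_derivative)
    have eul: "(\<Sum>e\<in>Basis. (y \<bullet> e) *\<^sub>R ?dF e y) = 0" "(\<Sum>e\<in>Basis. (y \<bullet> e) *\<^sub>R ?dH e y) = 0"
      using frechet_derivative_extend0_radial[OF dif(1)[OF False] False]
        frechet_derivative_extend0_radial[OF dif(2)[OF False] False]
        linear_sum[OF lin(1), of "\<lambda>e. (y \<bullet> e) *\<^sub>R e" Basis]
        linear_sum[OF lin(2), of "\<lambda>e. (y \<bullet> e) *\<^sub>R e" Basis]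
      by (simp_all add: euclidean_representation linear_scale[OF lin(1)] linear_scale[OF lin(2)])
    have "(\<Sum>e\<in>Basis. w e y) = (2 * \<rho>' (y \<bullet> y)) *\<^sub>R
        (?H y * (\<Sum>e\<in>Basis. (y \<bullet> e) *\<^sub>R ?dF e y) - ?F y * (\<Sum>e\<in>Basis. (y \<bullet> e) *\<^sub>R ?dH e y))"
      unfolding w_def W_def sum_distrib_left sum_subtractf[symmetric] scaleR_sum_right
      by (intro sum.cong) (auto simp: algebra_simps)
    then show ?thesis
      unfolding eul by simp
  qed (use a in \<open>simp add: w_def\<close>)
  have "(\<integral>y. (\<Sum>e\<in>Basis. v e y + w e y) \<partial>lborel) = (\<Sum>e\<in>Basis. (\<integral>y. v e y + w e y \<partial>lborel))"
    by (intro Bochner_Integration.integral_sum Bochner_Integration.integrable_add iv iw)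
  also have "\<dots> = 0"
    using zero by simp
  also have "(\<lambda>y. \<Sum>e\<in>Basis. v e y + w e y) = (\<lambda>y. \<Sum>e\<in>Basis. v e y)"
    by (simp add: sum.distrib radial)
  also have "\<dots> = (\<lambda>y. \<rho> (y \<bullet> y) *\<^sub>R (?H y * laplacian ?F y - ?F y * laplacian ?H y))"
    by (simp add: v_def laplacian_def sum_distrib_left sum_subtractf scaleR_sum_right[symmetric])
  finally show ?thesis .
qed

text \<open>
A continuously differentiable function that vanishes on the negative axis and increases to 1.
Rescaled copies of it approximate the indicator of an interval.
\<close>

definition smooth_step :: "real \<Rightarrow> real" where
  "smooth_step x = (max 0 x)\<^sup>2 / (1 + (max 0 x)\<^sup>2)"

definition smooth_step_deriv :: "real \<Rightarrow> real" where
  "smooth_step_deriv x = 2 * max 0 x / (1 + (max 0 x)\<^sup>2)\<^sup>2"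

lemma DERIV_max_0_square: "((\<lambda>x::real. (max 0 x)\<^sup>2) has_real_derivative 2 * max 0 x) (at x)"
proof -
  consider "x > 0" | "x < 0" | "x = 0" by linarith
  then show ?thesis
  proof cases
    case 1
    have "((\<lambda>x. x\<^sup>2) has_real_derivative 2 * x) (at x)"
      by (auto intro!: derivative_eq_intros)
    then have "((\<lambda>x::real. (max 0 x)\<^sup>2) has_real_derivative 2 * x) (at x)"
      by (rule has_field_derivative_transform_within_open[where S = "{0<..}"]) (use 1 in auto)
    then show ?thesis using 1 by simp
  next
    case 2
    have "((\<lambda>x. 0) has_real_derivative 0) (at x)" by simp
    then have "((\<lambda>x::real. (max 0 x)\<^sup>2) has_real_derivative 0) (at x)"
      by (rule has_field_derivative_transform_within_open[where S = "{..<0}"]) (use 2 in auto)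
    then show ?thesis using 2 by simp
  next
    case 3
    have "((\<lambda>h::real. max 0 h) \<longlongrightarrow> max 0 0) (at 0)"
      by (intro tendsto_intros)
    moreover have "\<forall>\<^sub>F h::real in at 0. max 0 h = ((max 0 (0 + h))\<^sup>2 - (max 0 0)\<^sup>2) / h"
      by (auto simp: eventually_at_filter max_def power2_eq_square)
    ultimately have "((\<lambda>h::real. ((max 0 (0 + h))\<^sup>2 - (max 0 0)\<^sup>2) / h) \<longlongrightarrow> max 0 0) (at 0)"
      by (rule Lim_transform_eventually)
    then show ?thesis
      using 3 by (simp add: DERIV_def)
  qed
qed

lemma smooth_step_simps:
  "x \<le> 0 \<Longrightarrow> smooth_step x = 0" "x \<le> 0 \<Longrightarrow> smooth_step_deriv x = 0"
  "0 \<le> smooth_step x" "smooth_step x \<le> 1"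
  by (auto simp: smooth_step_def smooth_step_deriv_def divide_le_eq add_pos_nonneg)

lemma one_plus_square_neq_0: "1 + (x::real)\<^sup>2 \<noteq> 0"
  by (smt (verit) zero_le_power2)

lemma DERIV_smooth_step: "(smooth_step has_real_derivative smooth_step_deriv x) (at x)"
proof -
  let ?m = "max 0 x"
  have "(smooth_step has_real_derivative
      ((2 * ?m) * (1 + ?m\<^sup>2) - ?m\<^sup>2 * (0 + 2 * ?m)) / ((1 + ?m\<^sup>2) * (1 + ?m\<^sup>2))) (at x)"
    unfolding smooth_step_def[abs_def]
    by (intro DERIV_divide DERIV_add DERIV_const DERIV_max_0_square one_plus_square_neq_0)
  also have "(2 * ?m) * (1 + ?m\<^sup>2) - ?m\<^sup>2 * (0 + 2 * ?m) = 2 * ?m"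
    by (simp add: algebra_simps)
  finally show ?thesis
    by (simp add: smooth_step_deriv_def power2_eq_square)
qed

lemma continuous_smooth_step: "continuous_on S smooth_step" "continuous_on S smooth_step_deriv"
  unfolding smooth_step_def[abs_def] smooth_step_deriv_def[abs_def]
  by (auto intro!: continuous_intros simp: one_plus_square_neq_0)

lemma smooth_step_tendsto_1:
  assumes "filterlim g at_top F"
  shows "((\<lambda>k. smooth_step (g k)) \<longlongrightarrow> 1) F"
proof -
  have "(smooth_step \<longlongrightarrow> 1) at_top"
  proof -
    have "((\<lambda>x::real. 1 - 1 / (1 + x\<^sup>2)) \<longlongrightarrow> 1 - 0) at_top"
      by real_asymp
    moreover have "\<forall>\<^sub>F x in at_top. 1 - 1 / (1 + x\<^sup>2) = smooth_step x"
      using eventually_ge_at_top[of 0]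
      by eventually_elim (simp add: smooth_step_def one_plus_square_neq_0 field_simps)
    ultimately have "(smooth_step \<longlongrightarrow> 1 - 0) at_top"
      by (rule Lim_transform_eventually)
    then show ?thesis by simp
  qed
  then show ?thesis
    using assms by (rule filterlim_compose)
qed

lemma continuous_on_smooth_S2: "f \<in> smooth_S2 \<Longrightarrow> continuous_on S2 f"
proof -
  assume f: "f \<in> smooth_S2"
  then have "Ck_on 0 (- {0}) (extend0 f)"
    by (auto simp: smooth_S2_def)
  then have "continuous_on S2 (extend0 f)"
    using S2_nonzero(1) by (auto intro: continuous_on_subset)
  then show "continuous_on S2 f"
    using S2_nonzero(2) by (simp add: extend0_def cong: continuous_on_cong)
qed

lemma closed_S2: "closed S2" and compact_S2: "compact S2"
  by (auto simp: S2_def)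

lemma sets_S2 [measurable]: "S2 \<in> sets borel"
  using closed_S2 by (rule borel_closed)

lemma smooth_S2_measurable:
  assumes "f \<in> smooth_S2"
  shows "f \<in> borel_measurable borel"
proof -
  have "(\<lambda>x. indicator S2 x *\<^sub>R f x) \<in> borel_measurable borel"
    using continuous_on_smooth_S2[OF assms] sets_S2
    by (rule borel_measurable_continuous_on_indicator[rotated])
  also have "(\<lambda>x. indicator S2 x *\<^sub>R f x) = f"
    using assms by (auto simp: smooth_S2_def fun_eq_iff indicator_def)
  finally show ?thesis .
qed

lemma smooth_S2_bounded:
  assumes "f \<in> smooth_S2"
  obtains B where "\<And>x. norm (f x) \<le> B"
proof -
  have "bounded (f ` S2)"
    using continuous_on_smooth_S2[OF assms] compact_S2
    by (intro compact_imp_bounded compact_continuous_image)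
  then obtain B where "\<And>x. x \<in> S2 \<Longrightarrow> norm (f x) \<le> B"
    unfolding bounded_iff by blast
  then have "norm (f x) \<le> max B 0" for x
    using assms by (cases "x \<in> S2") (force simp: smooth_S2_def)+
  then show ?thesis by (rule that)
qed

lemma sgn_measurable [measurable]: "(sgn :: real^3 \<Rightarrow> real^3) \<in> borel_measurable borel"
  unfolding sgn_div_norm[abs_def] by measurable

lemma borel_measurable_area:
  "G \<in> borel_measurable borel \<Longrightarrow> G \<in> borel_measurable area"
  unfolding area_def by (intro measurable_restrict_space1) simp

text \<open>
By definition the area is the image of the uniform distribution on the unit ball under \<^const>\<open>sgn\<close>.
\<close>

lemma integral_area:
  fixes G :: "real^3 \<Rightarrow> complex"
  assumes [measurable]: "G \<in> borel_measurable borel" and "\<And>x. x \<notin> S2 \<Longrightarrow> G x = 0"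
  shows "(\<integral>x. G x \<partial>area) =
    (\<integral>y. indicator (ball 0 1) y *\<^sub>R G (sgn y) \<partial>lborel) /\<^sub>R measure lborel (ball (0::real^3) 1)"
proof -
  let ?B = "ball (0::real^3) 1"
  define c where "c = measure lborel ?B"
  have c: "c > 0" "emeasure lborel ?B = ennreal c"
    unfolding c_def using emeasure_lborel_ball_finite[of "0::real^3" 1]
    by (auto simp: content_ball_pos emeasure_eq_ennreal_measure)
  have [measurable]: "(\<lambda>y. indicat_real ?B y / c) \<in> borel_measurable borel"
    by (intro borel_measurable_divide borel_measurable_indicator) auto
  have dens: "(\<lambda>y. indicator ?B y / emeasure lborel ?B) = (\<lambda>y. ennreal (indicator ?B y / c))"
    using c by (auto simp: fun_eq_iff indicator_def divide_ennreal[symmetric])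
  have "(\<integral>x. G x \<partial>area) = (\<integral>x. indicator S2 x *\<^sub>R G x \<partial>distr (uniform_measure lborel ?B) borel sgn)"
    unfolding area_def by (subst integral_restrict_space) auto
  also have "(\<lambda>x. indicator S2 x *\<^sub>R G x) = G"
    using assms(2) by (auto simp: fun_eq_iff indicator_def)
  also have "(\<integral>x. G x \<partial>distr (uniform_measure lborel ?B) borel sgn) =
      (\<integral>y. G (sgn y) \<partial>uniform_measure lborel ?B)"
    by (intro integral_distr) auto
  also have "\<dots> = (\<integral>y. (indicator ?B y / c) *\<^sub>R G (sgn y) \<partial>lborel)"
    unfolding uniform_measure_def dens using c by (subst integral_density) auto
  also have "(\<lambda>y. (indicator ?B y / c) *\<^sub>R G (sgn y)) = (\<lambda>y. inverse c *\<^sub>R (indicator ?B y *\<^sub>R G (sgn y)))"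
    by (auto simp: fun_eq_iff divide_inverse mult.commute)
  finally show ?thesis
    unfolding c_def by (simp only: integral_scaleR_right)
qed

text \<open>
Green's identity, applied to two eigenfunctions, says that the product of the extensions integrates to 0
over \<open>\<real>\<^sup>3\<close> with any admissible radial weight; the eigenvalue difference is a nonzero factor. Letting the
weight tend to the indicator of the unit ball turns this into an integral with respect to area.
\<close>

lemma harmonics_orthogonal:
  assumes f: "f \<in> harmonics n" and h: "h \<in> harmonics m" and "n \<noteq> m"
  shows "(\<integral>x. f x * h x \<partial>area) = 0"
proof -
  let ?F = "extend0 f" and ?H = "extend0 h"
  have fs: "f \<in> smooth_S2" and hs: "h \<in> smooth_S2"
    using f h by (auto simp: harmonics_iff)
  obtain Bf where Bf: "\<And>x. norm (f x) \<le> Bf" using smooth_S2_bounded[OF fs] by blast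
  obtain Bh where Bh: "\<And>x. norm (h x) \<le> Bh" using smooth_S2_bounded[OF hs] by blast
  have eigen: "laplacian (extend0 f) y = - of_nat (n * (n + 1)) * extend0 f y /\<^sub>R (y \<bullet> y)"
    if "f \<in> harmonics n" "y \<noteq> 0" for f n y
    using that laplacian_extend0[of f y]
    by (auto simp: harmonics_iff extend0_def S2_def norm_sgn)
  (* cutoff k tends to the indicator of the interval from 0 to 1 and vanishes outside [1/k, 1] *)
  define cutoff where "cutoff k s = smooth_step (k * s - 1) * smooth_step (k * (1 - s))" for k s :: real
  have cut: "0 \<le> cutoff k s" "cutoff k s \<le> 1" for k s
    unfolding cutoff_def using smooth_step_simps by (auto intro: mult_le_one)
  have van: "(\<integral>y. cutoff k (y \<bullet> y) *\<^sub>R (?F y * ?H y) \<partial>lborel) = 0" if k: "k \<ge> 1" for k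
  proof -
    (* the factor s compensates the factor 1 / (y \<bullet> y) in the Laplacian of an extension *)
    define \<rho> where "\<rho> s = s * cutoff k s" for s
    define \<rho>' where "\<rho>' s = cutoff k s + s * (k * smooth_step_deriv (k * s - 1) * smooth_step (k * (1 - s))
        - smooth_step (k * s - 1) * (k * smooth_step_deriv (k * (1 - s))))" for s
    have "(\<integral>y. \<rho> (y \<bullet> y) *\<^sub>R (?H y * laplacian ?F y - ?F y * laplacian ?H y) \<partial>lborel) = 0"
    proof (rule green_tangential[OF fs hs, where \<rho>' = \<rho>' and a = "1 / k" and b = 1])
      show "(\<rho> has_real_derivative \<rho>' s) (at s)" for s
      proof -
        have 1: "((\<lambda>s. smooth_step (k * s - 1)) has_real_derivative smooth_step_deriv (k * s - 1) * k) (at s)"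
          by (rule DERIV_chain2[OF DERIV_smooth_step]) (auto intro!: derivative_eq_intros)
        have 2: "((\<lambda>s. smooth_step (k * (1 - s))) has_real_derivative
            smooth_step_deriv (k * (1 - s)) * (- k)) (at s)"
          by (rule DERIV_chain2[OF DERIV_smooth_step]) (auto intro!: derivative_eq_intros)
        show ?thesis
          unfolding \<rho>_def[abs_def] \<rho>'_def cutoff_def
          by (rule derivative_eq_intros 1 2 refl)+ (simp add: algebra_simps)
      qed
      show "continuous_on UNIV \<rho>'"
        unfolding \<rho>'_def[abs_def] cutoff_def
        by (intro continuous_intros continuous_on_compose2[OF continuous_smooth_step(1)[of UNIV]]
            continuous_on_compose2[OF continuous_smooth_step(2)[of UNIV]]) auto
      show "0 < 1 / k" using k by simp
      show "\<rho> s = 0" "\<rho>' s = 0" if "s \<le> 1 / k" for s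
      proof -
        have "k * s - 1 \<le> 0" using that k by (simp add: field_simps)
        then show "\<rho> s = 0" "\<rho>' s = 0"
          by (simp_all add: \<rho>_def \<rho>'_def cutoff_def smooth_step_simps)
      qed
      show "\<rho> s = 0" "\<rho>' s = 0" if "s \<ge> 1" for s
      proof -
        have "k * (1 - s) \<le> 0" using that k by (simp add: mult_nonneg_nonpos)
        then show "\<rho> s = 0" "\<rho>' s = 0"
          by (simp_all add: \<rho>_def \<rho>'_def cutoff_def smooth_step_simps)
      qed
    qed
    also have "(\<lambda>y. \<rho> (y \<bullet> y) *\<^sub>R (?H y * laplacian ?F y - ?F y * laplacian ?H y)) =
       (\<lambda>y. (of_nat (m * (m + 1)) - of_nat (n * (n + 1))) * (cutoff k (y \<bullet> y) *\<^sub>R (?F y * ?H y)))"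
    proof
      fix y :: "real^3"
      show "\<rho> (y \<bullet> y) *\<^sub>R (?H y * laplacian ?F y - ?F y * laplacian ?H y) =
         (of_nat (m * (m + 1)) - of_nat (n * (n + 1))) * (cutoff k (y \<bullet> y) *\<^sub>R (?F y * ?H y))"
      proof (cases "y = 0")
        case True
        then show ?thesis by (simp add: \<rho>_def cutoff_def smooth_step_simps)
      next
        case False
        then have "y \<bullet> y \<noteq> 0" by simp
        then show ?thesis
          unfolding eigen[OF f False] eigen[OF h False] \<rho>_def scaleR_conv_of_real
          by (simp add: field_simps)
      qed
    qed
    finally have "(of_nat (m * (m + 1)) - of_nat (n * (n + 1)) :: complex) *
       (\<integral>y. cutoff k (y \<bullet> y) *\<^sub>R (?F y * ?H y) \<partial>lborel) = 0"
      by (simp only: integral_mult_right_zero)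
    moreover have mono: "a * (a + 1) < b * (b + 1)" if "a < b" for a b :: nat
      using that by (intro mult_strict_mono) auto
    have "m * (m + 1) \<noteq> n * (n + 1)"
      using \<open>n \<noteq> m\<close> mono[of m n] mono[of n m] by linarith
    then have "of_nat (m * (m + 1)) \<noteq> (of_nat (n * (n + 1)) :: complex)"
      unfolding of_nat_eq_iff .
    ultimately show ?thesis by simp
  qed
  have meas: "(\<lambda>y. f (sgn y) * h (sgn y)) \<in> borel_measurable borel"
    by (intro borel_measurable_times measurable_compose[OF sgn_measurable] smooth_S2_measurable fs hs)
  have F: "?F y * ?H y = f (sgn y) * h (sgn y)" for y
    by (simp add: extend0_def)
  have "(\<lambda>k. \<integral>y. cutoff (real (Suc k)) (y \<bullet> y) *\<^sub>R (?F y * ?H y) \<partial>lborel) \<longlonglongrightarrow>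
     (\<integral>y. indicator (ball 0 1) y *\<^sub>R (f (sgn y) * h (sgn y)) \<partial>lborel)"
  proof (rule integral_dominated_convergence[where w = "\<lambda>y. indicator (cball 0 1) y *\<^sub>R (Bf * Bh)"])
    show "(\<lambda>y. indicator (ball 0 1) y *\<^sub>R (f (sgn y) * h (sgn y))) \<in> borel_measurable lborel"
      using meas by (intro borel_measurable_scaleR borel_measurable_indicator) auto
    show "(\<lambda>y. cutoff (real (Suc k)) (y \<bullet> y) *\<^sub>R (?F y * ?H y)) \<in> borel_measurable lborel" for k
    proof -
      have "continuous_on UNIV (\<lambda>y::real^3. cutoff (real (Suc k)) (y \<bullet> y))"
        unfolding cutoff_def
        by (intro continuous_intros continuous_on_compose2[OF continuous_smooth_step(1)[of UNIV]]) auto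
      then show ?thesis
        unfolding F using meas
        by (intro borel_measurable_scaleR) (auto intro: borel_measurable_continuous_onI)
    qed
    show "integrable lborel (\<lambda>y::real^3. indicator (cball 0 1) y *\<^sub>R (Bf * Bh))"
      by (intro borel_integrable_compact) auto
    have ae: "AE y in lborel. (y::real^3) \<notin> {0}"
      using AE_lborel_singleton by auto
    have lim: "(\<lambda>k. cutoff (real (Suc k)) (y \<bullet> y)) \<longlonglongrightarrow> indicator (ball 0 1) y"
      if "y \<notin> {0}" for y :: "real^3"
    proof (cases "norm y < 1")
      case True
      have s: "0 < y \<bullet> y" "y \<bullet> y < 1"
        using that True by (auto simp: power2_norm_eq_inner[symmetric] power_less_one_iff)
      have "filterlim (\<lambda>k. (y \<bullet> y) * real (Suc k) - 1) at_top sequentially"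
        "filterlim (\<lambda>k. (1 - y \<bullet> y) * real (Suc k)) at_top sequentially"
        using s by real_asymp+
      then have "(\<lambda>k. smooth_step ((y \<bullet> y) * real (Suc k) - 1) * smooth_step ((1 - y \<bullet> y) * real (Suc k)))
          \<longlonglongrightarrow> 1 * 1"
        by (intro tendsto_mult smooth_step_tendsto_1)
      then show ?thesis
        using True by (simp add: cutoff_def mult.commute)
    next
      case False
      then have "y \<bullet> y \<ge> 1"
        by (simp add: power2_norm_eq_inner[symmetric] one_le_power)
      then have "cutoff (real (Suc k)) (y \<bullet> y) = 0" for k
        unfolding cutoff_def by (subst smooth_step_simps(1)[of "_ * (1 - _)"]) (auto simp: mult_nonneg_nonpos)
      then show ?thesis using False by simp
    qed
    from ae show "AE y in lborel. (\<lambda>k. cutoff (real (Suc k)) (y \<bullet> y) *\<^sub>R (?F y * ?H y)) \<longlonglongrightarrow>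
        indicator (ball 0 1) y *\<^sub>R (f (sgn y) * h (sgn y))"
      unfolding F by eventually_elim (intro tendsto_scaleR lim tendsto_const)
    show "AE y in lborel. norm (cutoff (real (Suc k)) (y \<bullet> y) *\<^sub>R (?F y * ?H y))
        \<le> indicator (cball 0 1) y *\<^sub>R (Bf * Bh)" for k
    proof (rule AE_I2)
      fix y :: "real^3"
      have FH: "norm (?F y * ?H y) \<le> Bf * Bh"
        unfolding F norm_mult using Bf Bh by (intro mult_mono) (auto intro: order_trans[OF norm_ge_zero])
      show "norm (cutoff (real (Suc k)) (y \<bullet> y) *\<^sub>R (?F y * ?H y)) \<le> indicator (cball 0 1) y *\<^sub>R (Bf * Bh)"
      proof (cases "norm y \<le> 1")
        case True
        have "norm (cutoff (real (Suc k)) (y \<bullet> y) *\<^sub>R (?F y * ?H y)) \<le> 1 * (Bf * Bh)"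
          unfolding norm_scaleR using cut[of "real (Suc k)" "y \<bullet> y"] FH by (intro mult_mono) auto
        then show ?thesis using True by simp
      next
        case False
        then have "y \<bullet> y \<ge> 1"
          by (simp add: power2_norm_eq_inner[symmetric] one_le_power)
        then have "cutoff (real (Suc k)) (y \<bullet> y) = 0"
          unfolding cutoff_def by (subst smooth_step_simps(1)[of "_ * (1 - _)"]) (auto simp: mult_nonneg_nonpos)
        then show ?thesis using False by simp
      qed
    qed
  qed
  then have "(\<integral>y. indicator (ball 0 1) y *\<^sub>R (f (sgn y) * h (sgn y)) \<partial>lborel) = 0"
    using van by (simp add: LIMSEQ_const_iff)
  then show ?thesis
    using fs borel_measurable_times[OF smooth_S2_measurable[OF fs] smooth_S2_measurable[OF hs]]
    by (subst integral_area) (auto simp: smooth_S2_def)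
qed

section \<open>Spectral projections and the coefficients of the random series\<close>

lemma harmonics_smooth: "f \<in> harmonics n \<Longrightarrow> f \<in> smooth_S2"
  by (simp add: harmonics_iff)

lemma smooth_S2_cnj: "f \<in> smooth_S2 \<Longrightarrow> (\<lambda>x. cnj (f x)) \<in> smooth_S2"
  by (rule smooth_S2_bounded_linear[OF bounded_linear_cnj])

lemma integrable_area_product:
  assumes "f \<in> smooth_S2" "h \<in> smooth_S2"
  shows "integrable area (\<lambda>x. f x * h x)"
proof -
  interpret prob_space area by (rule prob_space_area)
  obtain B where B: "\<And>x. norm (f x) \<le> B" using smooth_S2_bounded[OF assms(1)] by blast
  obtain C where C: "\<And>x. norm (h x) \<le> C" using smooth_S2_bounded[OF assms(2)] by blast
  show ?thesis
  proof (rule integrable_const_bound[where B = "B * C"])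
    show "AE x in area. norm (f x * h x) \<le> B * C"
      unfolding norm_mult using B C
      by (intro AE_I2 mult_mono) (auto intro: order_trans[OF norm_ge_zero])
    show "(\<lambda>x. f x * h x) \<in> borel_measurable area"
      by (intro borel_measurable_times borel_measurable_area smooth_S2_measurable assms)
  qed
qed

lemma integral_area_sum_right:
  assumes "h \<in> smooth_S2" "\<And>i. i \<in> I \<Longrightarrow> f i \<in> smooth_S2"
  shows "(\<integral>x. h x * (\<Sum>i\<in>I. c i * f i x) \<partial>area) = (\<Sum>i\<in>I. c i * (\<integral>x. h x * f i x \<partial>area))"
proof -
  have "(\<integral>x. h x * (\<Sum>i\<in>I. c i * f i x) \<partial>area) = (\<integral>x. (\<Sum>i\<in>I. c i * (h x * f i x)) \<partial>area)"
    by (simp add: sum_distrib_left mult.left_commute)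
  also have "\<dots> = (\<Sum>i\<in>I. \<integral>x. c i * (h x * f i x) \<partial>area)"
    using assms by (intro Bochner_Integration.integral_sum integrable_mult_right integrable_area_product)
  finally show ?thesis by simp
qed

lemma L2_inner_sum_left:
  assumes "e \<in> smooth_S2" "\<And>i. i \<in> I \<Longrightarrow> f i \<in> smooth_S2"
  shows "L2_inner (\<lambda>x. \<Sum>i\<in>I. c i * f i x) e = (\<Sum>i\<in>I. c i * L2_inner (f i) e)"
  using integral_area_sum_right[OF smooth_S2_cnj[OF assms(1)] assms(2), where c = c]
  by (simp add: L2_inner_def mult.commute)

lemma L2_inner_sum_right:
  assumes "e \<in> smooth_S2" "\<And>i. i \<in> I \<Longrightarrow> f i \<in> smooth_S2"
  shows "L2_inner e (\<lambda>x. \<Sum>i\<in>I. c i * f i x) = (\<Sum>i\<in>I. cnj (c i) * L2_inner e (f i))"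
  using integral_area_sum_right[OF assms(1) smooth_S2_cnj[OF assms(2)], where c = "\<lambda>i. cnj (c i)"]
  by (simp add: L2_inner_def)

text \<open>
The components of a test function can be extended by 0, so that every large summation bound serves.
This allows the bounds of several test functions to be unified.
\<close>

lemma test_functionsE:
  assumes "\<psi> \<in> test_functions"
  obtains N f where "\<And>n. f n \<in> harmonics n" "\<And>n. n > N \<Longrightarrow> f n = (\<lambda>x. 0)"
    "\<And>M. M \<ge> N \<Longrightarrow> \<psi> = (\<lambda>x. \<Sum>n\<le>M. f n x)"
proof -
  from assms obtain N f where f: "\<And>n. f n \<in> harmonics n" "\<psi> = (\<lambda>x. \<Sum>n\<le>N. f n x)"
    unfolding test_functions_def by blast
  define f' where "f' n = (if n \<le> N then f n else (\<lambda>x. 0))" for n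
  show thesis
  proof (rule that[of f' N])
    show "f' n \<in> harmonics n" for n
      using f(1) zero_in_harmonics by (simp add: f'_def)
    show "f' n = (\<lambda>x. 0)" if "n > N" for n
      using that by (simp add: f'_def)
    show "\<psi> = (\<lambda>x. \<Sum>n\<le>M. f' n x)" if "M \<ge> N" for M
    proof
      fix x
      have "(\<Sum>n\<le>M. f' n x) = (\<Sum>n\<le>N. f' n x)"
        using that by (intro sum.mono_neutral_right) (auto simp: f'_def)
      then show "\<psi> x = (\<Sum>n\<le>M. f' n x)"
        by (simp add: f(2) f'_def)
    qed
  qed
qed

lemma harmonics_test_functions: "f \<in> harmonics n \<Longrightarrow> f \<in> test_functions"
  unfolding test_functions_def
  by (intro CollectI exI[of _ n] exI[of _ "\<lambda>m. if m = n then f else (\<lambda>x. 0)"])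
     (auto simp: zero_in_harmonics fun_eq_iff if_distrib[of "\<lambda>f. f _"] cong: if_cong)

lemma test_functions_add:
  assumes "\<psi> \<in> test_functions" "\<eta> \<in> test_functions"
  shows "(\<lambda>x. \<psi> x + \<eta> x) \<in> test_functions"
proof -
  obtain N f where f: "\<And>n. f n \<in> harmonics n" "\<And>M. M \<ge> N \<Longrightarrow> \<psi> = (\<lambda>x. \<Sum>n\<le>M. f n x)"
    using test_functionsE[OF assms(1)] by metis
  obtain N' h where h: "\<And>n. h n \<in> harmonics n" "\<And>M. M \<ge> N' \<Longrightarrow> \<eta> = (\<lambda>x. \<Sum>n\<le>M. h n x)"
    using test_functionsE[OF assms(2)] by metis
  show ?thesis
    unfolding test_functions_def
    by (intro CollectI exI[of _ "max N N'"] exI[of _ "\<lambda>n x. f n x + h n x"])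
       (auto intro: harmonics_add f h simp: f(2)[of "max N N'"] h(2)[of "max N N'"] sum.distrib)
qed

lemma test_functions_scale:
  assumes "\<psi> \<in> test_functions"
  shows "(\<lambda>x. c * \<psi> x) \<in> test_functions"
proof -
  obtain N f where f: "\<And>n. f n \<in> harmonics n" "\<And>M. M \<ge> N \<Longrightarrow> \<psi> = (\<lambda>x. \<Sum>n\<le>M. f n x)"
    using test_functionsE[OF assms(1)] by metis
  show ?thesis
    unfolding test_functions_def
    by (intro CollectI exI[of _ N] exI[of _ "\<lambda>n x. c * f n x"])
       (auto intro: harmonics_scale f simp: f(2)[of N] sum_distrib_left)
qed

lemma test_functions_smooth:
  assumes "\<psi> \<in> test_functions"
  shows "\<psi> \<in> smooth_S2"
proof -
  from assms obtain N f where f: "\<And>n. f n \<in> harmonics n" "\<psi> = (\<lambda>x. \<Sum>n\<le>N. f n x)"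
    unfolding test_functions_def by blast
  have "(\<lambda>x. \<Sum>n\<le>N. f n x) \<in> smooth_S2" for N
    by (induction N) (simp_all add: smooth_S2_add(1) harmonics_smooth[OF f(1)])
  then show ?thesis using f(2) by simp
qed

lemma linear_functional_sum:
  assumes "linear_functional \<phi>" "finite I" "\<And>i. i \<in> I \<Longrightarrow> f i \<in> harmonics n"
  shows "\<phi> (\<lambda>x. \<Sum>i\<in>I. c i * f i x) = (\<Sum>i\<in>I. c i * \<phi> (f i))"
proof -
  have add: "\<phi> (\<lambda>x. \<psi> x + \<eta> x) = \<phi> \<psi> + \<phi> \<eta>" and scale: "\<phi> (\<lambda>x. c * \<psi> x) = c * \<phi> \<psi>"
    if "\<psi> \<in> test_functions" "\<eta> \<in> test_functions" for \<psi> \<eta> c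
    using assms(1) that unfolding linear_functional_def by blast+
  have z: "\<phi> (\<lambda>x. 0) = 0"
    using scale[of "\<lambda>x. 0" "\<lambda>x. 0" 0] harmonics_test_functions[OF zero_in_harmonics] by simp
  show ?thesis
    using assms(2,3)
  proof (induction I)
    case empty
    then show ?case by (simp add: z)
  next
    case (insert i I)
    have "(\<lambda>x. \<Sum>i\<in>I. c i * f i x) \<in> test_functions"
      using insert by (intro harmonics_test_functions[of _ n] harmonics_sum) auto
    moreover have "f i \<in> test_functions" "(\<lambda>x. c i * f i x) \<in> test_functions"
      using insert by (auto intro: harmonics_test_functions test_functions_scale)
    ultimately show ?case
      using insert add[of "\<lambda>x. c i * f i x" "\<lambda>x. \<Sum>i\<in>I. c i * f i x"] scale[of "f i" "f i"]
      by simp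
  qed
qed

text \<open>
The description of the projection determines the coordinates in the basis: testing with \<open>b k\<close> gives the
coordinate of index \<open>k\<close>, and conversely linearity of \<open>\<phi>\<close> on the finite-dimensional space of harmonics
extends the relation from the basis to all of it.
\<close>

lemma harmonic_proj_eq:
  assumes ob: "orthonormal_basis I b (harmonics n)" and lin: "linear_functional \<phi>"
  shows "harmonic_proj n \<phi> = (\<lambda>x. \<Sum>k\<in>I. \<phi> (\<lambda>y. cnj (b k y)) * b k x)"
proof -
  from ob have fin: "finite I" and b: "\<And>i. i \<in> I \<Longrightarrow> b i \<in> harmonics n"
    and on: "\<And>i j. i \<in> I \<Longrightarrow> j \<in> I \<Longrightarrow> L2_inner (b i) (b j) = (if i = j then 1 else 0)"
    and span: "\<And>f. f \<in> harmonics n \<Longrightarrow> \<exists>c. f = (\<lambda>x. \<Sum>i\<in>I. c i * b i x)"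
    unfolding orthonormal_basis_def by auto
  note bs = b[THEN harmonics_smooth]
  have coef: "L2_inner (\<lambda>x. \<Sum>i\<in>I. c i * b i x) (b k) = c k" if "k \<in> I" for c k
    using that fin by (subst L2_inner_sum_left) (auto simp: bs on if_distrib cong: if_cong)
  let ?f = "\<lambda>x. \<Sum>k\<in>I. \<phi> (\<lambda>y. cnj (b k y)) * b k x"
  show ?thesis
    unfolding harmonic_proj_def
  proof (rule the_equality)
    have "?f \<in> harmonics n"
      using fin b by (rule harmonics_sum)
    moreover have "L2_inner ?f e = \<phi> (\<lambda>x. cnj (e x))" if e: "e \<in> harmonics n" for e
    proof -
      from span[OF e] obtain c where c: "e = (\<lambda>x. \<Sum>i\<in>I. c i * b i x)" by blast
      have "L2_inner ?f e = (\<Sum>i\<in>I. cnj (c i) * L2_inner ?f (b i))"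
        unfolding c using \<open>?f \<in> harmonics n\<close> by (intro L2_inner_sum_right bs) (rule harmonics_smooth)
      also have "\<dots> = (\<Sum>i\<in>I. cnj (c i) * \<phi> (\<lambda>y. cnj (b i y)))"
        by (intro sum.cong refl) (simp only: coef)
      also have "\<dots> = \<phi> (\<lambda>x. \<Sum>i\<in>I. cnj (c i) * cnj (b i x))"
        using linear_functional_sum[OF lin fin, of "\<lambda>i x. cnj (b i x)" n "\<lambda>i. cnj (c i)"]
        by (simp add: b harmonics_cnj)
      finally show ?thesis by (simp add: c)
    qed
    ultimately show "?f \<in> harmonics n \<and> (\<forall>e\<in>harmonics n. L2_inner ?f e = \<phi> (\<lambda>x. cnj (e x)))"
      by blast
  next
    fix f
    assume f: "f \<in> harmonics n \<and> (\<forall>e\<in>harmonics n. L2_inner f e = \<phi> (\<lambda>x. cnj (e x)))"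
    then obtain c where c: "f = (\<lambda>x. \<Sum>i\<in>I. c i * b i x)" using span by blast
    have "c k = \<phi> (\<lambda>y. cnj (b k y))" if "k \<in> I" for k
      using f b[OF that] coef[OF that, of c] by (simp add: c)
    then show "f = ?f"
      by (simp add: c)
  qed
qed

lemma finite_degree_orders: "finite (degree_orders n)"
proof -
  have "degree_orders n = {- int n..int n}"
    by (auto simp: degree_orders_def)
  then show ?thesis by simp
qed

lemma card_degree_orders: "card (degree_orders n) = 2 * n + 1"
proof -
  have "degree_orders n = {- int n..int n}"
    by (auto simp: degree_orders_def)
  then show ?thesis by simp
qed

context
  fixes b :: "nat \<Rightarrow> int \<Rightarrow> real^3 \<Rightarrow> complex"
  assumes b: "\<And>n. orthonormal_basis (degree_orders n) (b n) (harmonics n)"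
begin

lemma basis_harmonic: "k \<in> degree_orders n \<Longrightarrow> b n k \<in> harmonics n"
  using b unfolding orthonormal_basis_def by blast

lemma basis_orthonormal:
  assumes "k \<in> degree_orders n" "l \<in> degree_orders m"
  shows "(\<integral>x. b m l x * cnj (b n k x) \<partial>area) = (if m = n \<and> l = k then 1 else 0)"
proof (cases "m = n")
  case True
  then show ?thesis
    using b[of n] assms unfolding orthonormal_basis_def L2_inner_def by auto
next
  case False
  then show ?thesis
    using harmonics_orthogonal[OF basis_harmonic[OF assms(2)] harmonics_cnj[OF basis_harmonic[OF assms(1)]]]
    by simp
qed

text \<open>
Against a test function only finitely many terms of the series survive, by orthogonality of different
degrees. So the series may be added termwise.
\<close>

lemma linear_functional_random_series: "linear_functional (random_series \<alpha> b g \<omega>)"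
proof -
  define T where "T \<psi> n = complex_of_real (1 / freq n powr \<alpha>) *
        (\<Sum>k\<in>degree_orders n. g n k \<omega> * (\<integral>x. b n k x * \<psi> x \<partial>area))" for \<psi> n
  have R: "random_series \<alpha> b g \<omega> \<psi> = (\<Sum>n. T \<psi> n)" if "\<psi> \<in> test_functions" for \<psi>
    using that by (simp add: random_series_def T_def)
  have sm: "summable (T \<psi>)" if \<psi>: "\<psi> \<in> test_functions" for \<psi>
  proof -
    obtain N f where f: "\<And>n. f n \<in> harmonics n" "\<And>M. M \<ge> N \<Longrightarrow> \<psi> = (\<lambda>x. \<Sum>n\<le>M. f n x)"
      using test_functionsE[OF \<psi>] by metis
    show ?thesis
    proof (rule summable_finite[of "{..N}"])
      fix n assume "n \<notin> {..N}"
      then have n: "n > N" by simp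
      have "(\<integral>x. b n k x * \<psi> x \<partial>area) = 0" if "k \<in> degree_orders n" for k
      proof -
        note bh = basis_harmonic[OF that]
        have "(\<integral>x. b n k x * \<psi> x \<partial>area) = (\<integral>x. b n k x * (\<Sum>m\<le>N. 1 * f m x) \<partial>area)"
          by (simp add: f(2)[of N])
        also have "\<dots> = (\<Sum>m\<le>N. 1 * (\<integral>x. b n k x * f m x \<partial>area))"
          by (intro integral_area_sum_right harmonics_smooth[OF bh] harmonics_smooth[OF f(1)])
        also have "\<dots> = 0"
          using n by (intro sum.neutral ballI) (simp add: harmonics_orthogonal[OF bh f(1)])
        finally show ?thesis .
      qed
      then show "T \<psi> n = 0"
        by (simp add: T_def)
    qed simp
  qed
  have int: "integrable area (\<lambda>x. b n k x * \<psi> x)"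
    if "\<psi> \<in> test_functions" "k \<in> degree_orders n" for \<psi> n k
    using that by (intro integrable_area_product harmonics_smooth[OF basis_harmonic] test_functions_smooth)
  have "(\<Sum>n. T (\<lambda>x. \<psi> x + \<eta> x) n) = (\<Sum>n. T \<psi> n) + (\<Sum>n. T \<eta> n)"
    if "\<psi> \<in> test_functions" "\<eta> \<in> test_functions" for \<psi> \<eta>
  proof -
    have "T (\<lambda>x. \<psi> x + \<eta> x) n = T \<psi> n + T \<eta> n" for n
      using that
      by (simp add: T_def distrib_left int Bochner_Integration.integral_add sum.distrib
          add_divide_distrib cong: sum.cong)
    then show ?thesis
      using suminf_add[OF sm sm] that by simp
  qed
  moreover have "(\<Sum>n. T (\<lambda>x. c * \<psi> x) n) = c * (\<Sum>n. T \<psi> n)" if "\<psi> \<in> test_functions" for \<psi> c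
  proof -
    have "T (\<lambda>x. c * \<psi> x) n = c * T \<psi> n" for n
      by (simp add: T_def mult.left_commute[of _ c] sum_distrib_left)
    then show ?thesis
      using suminf_mult[OF sm[OF that]] by simp
  qed
  ultimately show ?thesis
    unfolding linear_functional_def
    by (auto simp: R test_functions_add test_functions_scale)
qed

lemma random_series_coefficient:
  assumes k: "k \<in> degree_orders n"
  shows "random_series \<alpha> b g \<omega> (\<lambda>x. cnj (b n k x)) = complex_of_real (1 / freq n powr \<alpha>) * g n k \<omega>"
proof -
  have "(\<lambda>x. cnj (b n k x)) \<in> test_functions"
    using k by (intro harmonics_test_functions[OF harmonics_cnj[OF basis_harmonic]])
  then have "random_series \<alpha> b g \<omega> (\<lambda>x. cnj (b n k x)) =
     (\<Sum>m. complex_of_real (1 / freq m powr \<alpha>) *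
        (\<Sum>l\<in>degree_orders m. g m l \<omega> * (if m = n \<and> l = k then 1 else 0)))"
    by (simp add: random_series_def basis_orthonormal[OF k] cong: sum.cong)
  also have "\<dots> = (\<Sum>m\<in>{n}. complex_of_real (1 / freq m powr \<alpha>) *
        (\<Sum>l\<in>degree_orders m. g m l \<omega> * (if m = n \<and> l = k then 1 else 0)))"
    by (intro suminf_finite) auto
  also have "\<dots> = complex_of_real (1 / freq n powr \<alpha>) * g n k \<omega>"
    using k finite_degree_orders by (simp add: if_distrib cong: if_cong)
  finally show ?thesis .
qed

lemma random_series_measurable:
  assumes "\<And>n k. k \<in> degree_orders n \<Longrightarrow> g n k \<in> borel_measurable P"
  shows "random_series \<alpha> b g \<in> measurable P distributions_S2"
  unfolding distributions_S2_def
proof (rule measurable_restrict_space2)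
  show "random_series \<alpha> b g \<in> space P \<rightarrow> {\<phi>. linear_functional \<phi>}"
    by (auto intro: linear_functional_random_series)
  show "random_series \<alpha> b g \<in> measurable P (PiM test_functions (\<lambda>_. borel))"
    unfolding random_series_def[abs_def]
    using assms
    by (intro measurable_restrict borel_measurable_suminf borel_measurable_times borel_measurable_sum
        borel_measurable_const)
qed

end

section \<open>Exponential moments of complex Gaussian sums\<close>

text \<open>
Completing the square: multiplication of a Gaussian density by an exponential shifts its centre.
\<close>

lemma nn_integral_exp_normal:
  "(\<integral>\<^sup>+u. ennreal (exp (a * u)) \<partial>density lborel (normal_density 0 (1 / sqrt 2))) = ennreal (exp (a\<^sup>2 / 4))"
proof -
  let ?\<sigma> = "1 / sqrt 2"
  have eq: "normal_density 0 ?\<sigma> u * exp (a * u) = exp (a\<^sup>2 / 4) * normal_density (a / 2) ?\<sigma> u" for u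
    by (simp add: normal_density_def exp_add[symmetric] power2_eq_square field_simps)
  have 1: "(\<integral>\<^sup>+u. ennreal (normal_density (a / 2) ?\<sigma> u) \<partial>lborel) = 1"
    by (subst nn_integral_eq_integral) auto
  have "(\<integral>\<^sup>+u. ennreal (exp (a * u)) \<partial>density lborel (normal_density 0 ?\<sigma>)) =
      (\<integral>\<^sup>+u. ennreal (normal_density 0 ?\<sigma> u) * ennreal (exp (a * u)) \<partial>lborel)"
    by (subst nn_integral_density) auto
  also have "\<dots> = (\<integral>\<^sup>+u. ennreal (exp (a\<^sup>2 / 4)) * ennreal (normal_density (a / 2) ?\<sigma> u) \<partial>lborel)"
    by (simp add: ennreal_mult[symmetric] eq)
  also have "\<dots> = ennreal (exp (a\<^sup>2 / 4))"
    by (subst nn_integral_cmult) (auto simp: 1)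
  finally show ?thesis .
qed

lemma borel_measurable_Complex_pair: "(\<lambda>(u, v). Complex u v) \<in> borel_measurable (borel \<Otimes>\<^sub>M borel)"
  unfolding Complex_eq[abs_def] case_prod_beta
  by (intro borel_measurable_add borel_measurable_times borel_measurable_const)
     (auto intro!: measurable_compose[OF measurable_fst] measurable_compose[OF measurable_snd]
        borel_measurable_continuous_onI continuous_intros)

text \<open>
The real part of \<open>v * z\<close> is a combination of the two independent coordinates of \<open>z\<close>, each of variance 1/2.
\<close>

lemma nn_integral_exp_std_complex_gaussian:
  "(\<integral>\<^sup>+z. ennreal (exp (Re (v * z))) \<partial>std_complex_gaussian) = ennreal (exp ((cmod v)\<^sup>2 / 4))"
proof -
  let ?N = "density lborel (normal_density 0 (1 / sqrt 2))"
  interpret N: prob_space ?N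
    by (rule prob_space_normal_density) simp
  have sN: "sets (?N \<Otimes>\<^sub>M ?N) = sets (borel \<Otimes>\<^sub>M borel)"
    by (intro sets_pair_measure_cong) auto
  have mc: "(\<lambda>(u, v). Complex u v) \<in> borel_measurable (?N \<Otimes>\<^sub>M ?N)"
    using borel_measurable_Complex_pair by (subst measurable_cong_sets[OF sN refl])
  have "(\<integral>\<^sup>+z. ennreal (exp (Re (v * z))) \<partial>std_complex_gaussian) =
     (\<integral>\<^sup>+p. ennreal (exp (Re (v * (case p of (u, w) \<Rightarrow> Complex u w)))) \<partial>(?N \<Otimes>\<^sub>M ?N))"
    unfolding std_complex_gaussian_def
    by (subst nn_integral_distr[OF mc]) auto
  also have "\<dots> = (\<integral>\<^sup>+p. ennreal (exp (Re v * fst p)) * ennreal (exp (- Im v * snd p)) \<partial>(?N \<Otimes>\<^sub>M ?N))"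
    by (simp add: case_prod_beta ennreal_mult[symmetric] exp_add[symmetric])
  also have "\<dots> = (\<integral>\<^sup>+u. \<integral>\<^sup>+w. ennreal (exp (Re v * u)) * ennreal (exp (- Im v * w)) \<partial>?N \<partial>?N)"
    by (subst N.nn_integral_fst[symmetric]) auto
  also have "\<dots> = (\<integral>\<^sup>+u. ennreal (exp (Re v * u)) * ennreal (exp ((- Im v)\<^sup>2 / 4)) \<partial>?N)"
    by (subst nn_integral_cmult) (auto simp only: nn_integral_exp_normal, auto)
  also have "\<dots> = ennreal (exp ((Re v)\<^sup>2 / 4)) * ennreal (exp ((- Im v)\<^sup>2 / 4))"
    by (subst nn_integral_multc) (auto simp only: nn_integral_exp_normal, auto)
  also have "\<dots> = ennreal (exp ((cmod v)\<^sup>2 / 4))"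
    by (simp add: ennreal_mult[symmetric] exp_add[symmetric] cmod_power2 add_divide_distrib)
  finally show ?thesis .
qed

lemma (in prob_space) nn_integral_exp_iid_std_complex_gaussian:
  assumes iid: "iid_std_complex_gaussian M I X" and J: "finite J" "J \<subseteq> I"
  shows "(\<integral>\<^sup>+\<omega>. ennreal (exp (Re (\<Sum>i\<in>J. v i * X i \<omega>))) \<partial>M) = ennreal (exp ((\<Sum>i\<in>J. (cmod (v i))\<^sup>2) / 4))"
proof -
  have ind: "indep_vars (\<lambda>_. borel) X J"
    using iid J(2) unfolding iid_std_complex_gaussian_def by (blast intro: indep_vars_subset)
  then have rv: "random_variable borel (X i)" if "i \<in> J" for i
    using that by (auto simp: indep_vars_def)
  have ind': "indep_vars (\<lambda>_. borel) (\<lambda>i \<omega>. ennreal (exp (Re (v i * X i \<omega>)))) J"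
    using ind by (rule indep_vars_compose2) auto
  have "(\<integral>\<^sup>+\<omega>. ennreal (exp (Re (\<Sum>i\<in>J. v i * X i \<omega>))) \<partial>M) =
      (\<integral>\<^sup>+\<omega>. (\<Prod>i\<in>J. ennreal (exp (Re (v i * X i \<omega>)))) \<partial>M)"
    using J(1) by (simp add: prod_ennreal Re_sum exp_sum del: times_complex.sel)
  also have "\<dots> = (\<Prod>i\<in>J. \<integral>\<^sup>+\<omega>. ennreal (exp (Re (v i * X i \<omega>))) \<partial>M)"
    using J(1) ind' by (rule indep_vars_nn_integral) auto
  also have "\<dots> = (\<Prod>i\<in>J. ennreal (exp ((cmod (v i))\<^sup>2 / 4)))"
  proof (rule prod.cong[OF refl])
    fix i assume i: "i \<in> J"
    have "(\<integral>\<^sup>+\<omega>. ennreal (exp (Re (v i * X i \<omega>))) \<partial>M) = (\<integral>\<^sup>+z. ennreal (exp (Re (v i * z))) \<partial>distr M borel (X i))"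
      using rv[OF i] by (subst nn_integral_distr) auto
    also have "distr M borel (X i) = std_complex_gaussian"
      using iid i J(2) unfolding iid_std_complex_gaussian_def by blast
    finally show "(\<integral>\<^sup>+\<omega>. ennreal (exp (Re (v i * X i \<omega>))) \<partial>M) = ennreal (exp ((cmod (v i))\<^sup>2 / 4))"
      by (simp only: nn_integral_exp_std_complex_gaussian)
  qed
  also have "\<dots> = ennreal (exp ((\<Sum>i\<in>J. (cmod (v i))\<^sup>2) / 4))"
    using J(1) by (simp add: prod_ennreal exp_sum sum_divide_distrib)
  finally show ?thesis .
qed

section \<open>Deterministic convergence of dyadic blocks\<close>

definition phase :: "real \<Rightarrow> nat \<Rightarrow> complex" where
  "phase t n = exp (- (\<i> * complex_of_real (t * (real n * (real n + 1)))))"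

definition dyadic_block :: "nat \<Rightarrow> nat set" where
  "dyadic_block j = {2 ^ j<..2 ^ Suc j}"

definition block_sum :: "(nat \<Rightarrow> complex) \<Rightarrow> nat \<Rightarrow> real \<Rightarrow> complex" where
  "block_sum a j t = (\<Sum>n\<in>dyadic_block j. phase t n * a n)"

text \<open>
The times of mesh \<open>2^(-6j)\<close> in the interval from \<open>-2^j\<close> to \<open>2^j\<close>. The intervals grow with \<open>j\<close>, so that every
time is eventually covered.
\<close>

definition time_grid :: "nat \<Rightarrow> real set" where
  "time_grid j = (\<lambda>i::int. real_of_int i / 2 ^ (6 * j)) ` {- (2 ^ (7 * j))..2 ^ (7 * j)}"

text \<open>
The modulus of a complex number \<open>z\<close> is controlled by the real parts of \<open>\<zeta> * z\<close> for these four \<open>\<zeta>\<close>.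
\<close>

definition quarter_turns :: "complex set" where
  "quarter_turns = {1, - 1, \<i>, - \<i>}"

text \<open>
Bounds on this quantity that are uniform in \<open>j\<close> control the blocks of \<open>a\<close> on whole intervals. The first
part measures the block on the time grid in units of \<open>q^j\<close>. The grid has about \<open>2^(7j)\<close> points, and the
weight \<open>2^(-8j)\<close> outweighs their number. The second part is a Lipschitz constant of the block. Its mean is
of order \<open>2^(4j)\<close> for the random coefficients below, which the weight \<open>2^(-5j)\<close> outweighs, while \<open>2^(5j)\<close>
times the mesh \<open>2^(-6j)\<close> is still summable.
\<close>

definition block_gauge :: "real \<Rightarrow> (nat \<Rightarrow> complex) \<Rightarrow> nat \<Rightarrow> real" where
  "block_gauge q a j =
     (\<Sum>t\<in>time_grid j. \<Sum>\<zeta>\<in>quarter_turns. exp (Re (\<zeta> * block_sum a j t) / q ^ j)) / 2 ^ (8 * j) +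
     (\<Sum>n\<in>dyadic_block j. real n * (real n + 1) * cmod (a n)) / 2 ^ (5 * j)"

lemma block_gauge_parts:
  "0 \<le> (\<Sum>t\<in>time_grid j. \<Sum>\<zeta>\<in>quarter_turns. exp (Re (\<zeta> * block_sum a j t) / q ^ j)) / 2 ^ (8 * j)"
  "0 \<le> (\<Sum>n\<in>dyadic_block j. real n * (real n + 1) * cmod (a n)) / 2 ^ (5 * j)"
  by (auto intro!: divide_nonneg_nonneg sum_nonneg mult_nonneg_nonneg)

lemma finite_time_grid: "finite (time_grid j)"
  by (simp add: time_grid_def)

lemma norm_phase_diff: "cmod (phase t n - phase s n) \<le> \<bar>t - s\<bar> * (real n * (real n + 1))"
proof -
  define x where "x = - ((t - s) * (real n * (real n + 1)))"
  have "phase t n = phase s n * iexp x"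
    unfolding phase_def x_def exp_add[symmetric] by (simp add: algebra_simps)
  then have "cmod (phase t n - phase s n) = cmod (phase s n) * cmod (iexp x - 1)"
    unfolding norm_mult[symmetric] by (simp add: algebra_simps)
  also have "cmod (phase s n) = 1"
    by (simp add: phase_def)
  also have "cmod (iexp x - 1) \<le> \<bar>x\<bar>"
    using iexp_approx1[of x 0] by simp
  finally show ?thesis
    by (simp add: x_def abs_mult)
qed

lemma nearby_grid_point:
  assumes "\<bar>t\<bar> \<le> 2 ^ j"
  obtains s where "s \<in> time_grid j" "\<bar>t - s\<bar> \<le> 1 / 2 ^ (6 * j)"
proof -
  define i where "i = \<lfloor>t * 2 ^ (6 * j)\<rfloor>"
  have "\<bar>t * 2 ^ (6 * j)\<bar> \<le> 2 ^ j * 2 ^ (6 * j)"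
    using assms by (simp add: abs_mult)
  also have "\<dots> = (2 ^ (7 * j) :: real)"
    by (simp add: power_add[symmetric])
  finally have "- (2 ^ (7 * j)) \<le> t * 2 ^ (6 * j)" "t * 2 ^ (6 * j) \<le> 2 ^ (7 * j)"
    by auto
  then have "- (2 ^ (7 * j)) \<le> i" "i \<le> 2 ^ (7 * j)"
    unfolding i_def by (simp_all add: le_floor_iff floor_le_iff)
  then have "real_of_int i / 2 ^ (6 * j) \<in> time_grid j"
    by (auto simp: time_grid_def)
  moreover have "\<bar>t - real_of_int i / 2 ^ (6 * j)\<bar> \<le> 1 / 2 ^ (6 * j)"
  proof -
    have "\<bar>t * 2 ^ (6 * j) - real_of_int i\<bar> \<le> 1"
      unfolding i_def by linarith
    then have "\<bar>t * 2 ^ (6 * j) - real_of_int i\<bar> / 2 ^ (6 * j) \<le> 1 / 2 ^ (6 * j)"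
      by (intro divide_right_mono) auto
    also have "\<bar>t * 2 ^ (6 * j) - real_of_int i\<bar> / 2 ^ (6 * j) = \<bar>(t * 2 ^ (6 * j) - real_of_int i) / 2 ^ (6 * j)\<bar>"
      by simp
    also have "(t * 2 ^ (6 * j) - real_of_int i) / 2 ^ (6 * j) = t - real_of_int i / 2 ^ (6 * j)"
      by (simp add: diff_divide_distrib)
    finally show ?thesis .
  qed
  ultimately show ?thesis by (rule that)
qed

lemma abs_le_of_exp_sum:
  fixes x s K :: real
  assumes "exp (x / s) \<le> K" "exp (- x / s) \<le> K" "s > 0"
  shows "\<bar>x\<bar> \<le> s * ln K"
proof -
  have K: "K > 0"
    using assms(1) exp_gt_zero[of "x / s"] by linarith
  have "x / s \<le> ln K" "- x / s \<le> ln K"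
    using assms K by (simp_all add: ln_ge_iff)
  then show ?thesis
    using assms(3) by (simp add: field_simps abs_le_iff)
qed

text \<open>
An exponential that is at most \<open>S * 2^(8j)\<close> has exponent at most \<open>ln S + 8j\<close>; this bounds the block at the
nearest grid point, and the Lipschitz constant bounds the difference.
\<close>

lemma block_sum_bound:
  assumes q: "0 < q" and S: "1 \<le> S" "block_gauge q a j \<le> S" and t: "\<bar>t\<bar> \<le> 2 ^ j"
  shows "cmod (block_sum a j t) \<le> 2 * (ln S + 8) * (real (Suc j) * q ^ j) + S * (1 / 2) ^ j"
proof -
  obtain s where s: "s \<in> time_grid j" "\<bar>t - s\<bar> \<le> 1 / 2 ^ (6 * j)"
    using nearby_grid_point[OF t] .
  define L where "L = (\<Sum>n\<in>dyadic_block j. real n * (real n + 1) * cmod (a n))"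
  have L: "L \<le> S * 2 ^ (5 * j)"
  proof -
    have "L / 2 ^ (5 * j) \<le> S"
      using S(2) block_gauge_parts(1)[where q = q and a = a and j = j] unfolding block_gauge_def L_def by linarith
    then show ?thesis by (simp add: divide_le_eq)
  qed
  have "cmod (block_sum a j t - block_sum a j s) = cmod (\<Sum>n\<in>dyadic_block j. (phase t n - phase s n) * a n)"
    by (simp add: block_sum_def sum_subtractf left_diff_distrib)
  also have "\<dots> \<le> (\<Sum>n\<in>dyadic_block j. \<bar>t - s\<bar> * (real n * (real n + 1)) * cmod (a n))"
    by (intro sum_norm_le) (auto simp: norm_mult intro!: mult_right_mono norm_phase_diff)
  also have "\<dots> = \<bar>t - s\<bar> * L"
    by (simp add: L_def sum_distrib_left mult.assoc)
  also have "\<dots> \<le> 1 / 2 ^ (6 * j) * (S * 2 ^ (5 * j))"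
    using s(2) L by (intro mult_mono) (auto simp: L_def intro!: sum_nonneg)
  also have "\<dots> = S * (1 / 2) ^ j"
  proof -
    have "(2::real) ^ (6 * j) = 2 ^ (5 * j) * 2 ^ j"
      by (simp add: power_add[symmetric])
    then show ?thesis by (simp add: field_simps)
  qed
  finally have diff: "cmod (block_sum a j t - block_sum a j s) \<le> S * (1 / 2) ^ j" .
  define K :: real where "K = S * 2 ^ (8 * j)"
  let ?w = "block_sum a j s"
  have "(\<Sum>t\<in>time_grid j. \<Sum>\<zeta>\<in>quarter_turns. exp (Re (\<zeta> * block_sum a j t) / q ^ j)) / 2 ^ (8 * j) \<le> S"
    using S(2) block_gauge_parts(2)[where a = a and j = j] unfolding block_gauge_def by linarith
  then have "(\<Sum>t\<in>time_grid j. \<Sum>\<zeta>\<in>quarter_turns. exp (Re (\<zeta> * block_sum a j t) / q ^ j)) \<le> K"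
    by (simp add: divide_le_eq K_def)
  moreover have "(\<Sum>\<zeta>\<in>quarter_turns. exp (Re (\<zeta> * ?w) / q ^ j)) \<le>
    (\<Sum>t\<in>time_grid j. \<Sum>\<zeta>\<in>quarter_turns. exp (Re (\<zeta> * block_sum a j t) / q ^ j))"
    by (rule member_le_sum[OF s(1)]) (auto simp: finite_time_grid intro!: sum_nonneg)
  moreover have "exp (Re (\<zeta> * ?w) / q ^ j) \<le> (\<Sum>\<zeta>\<in>quarter_turns. exp (Re (\<zeta> * ?w) / q ^ j))"
    if "\<zeta> \<in> quarter_turns" for \<zeta>
    by (rule member_le_sum[OF that]) (auto simp: quarter_turns_def)
  ultimately have turn: "exp (Re (\<zeta> * ?w) / q ^ j) \<le> K" if "\<zeta> \<in> quarter_turns" for \<zeta>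
    using that by force
  have "\<bar>Re ?w\<bar> \<le> q ^ j * ln K"
    using turn[of 1] turn[of "- 1"] q by (intro abs_le_of_exp_sum) (auto simp: quarter_turns_def)
  moreover have "\<bar>Im ?w\<bar> \<le> q ^ j * ln K"
    using turn[of "- \<i>"] turn[of "\<i>"] q by (intro abs_le_of_exp_sum) (auto simp: quarter_turns_def)
  ultimately have "cmod ?w \<le> 2 * (q ^ j * ln K)"
    using cmod_le[of ?w] by linarith
  also have "\<dots> \<le> 2 * (q ^ j * ((ln S + 8) * real (Suc j)))"
  proof -
    have "ln K = ln S + real (8 * j) * ln 2"
      using S(1) by (simp add: K_def ln_mult ln_realpow)
    also have "\<dots> \<le> ln S + real (8 * j)"
      using ln_2_less_1 by (intro add_left_mono mult_left_le) auto
    also have "\<dots> \<le> (ln S + 8) * real (Suc j)"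
      using S(1) by (simp add: algebra_simps)
    finally show ?thesis
      using q by (intro mult_left_mono) auto
  qed
  finally have "cmod ?w \<le> 2 * (ln S + 8) * (real (Suc j) * q ^ j)"
    by (simp only: mult_ac)
  moreover have "cmod (block_sum a j t) \<le> cmod ?w + cmod (block_sum a j t - ?w)"
    using norm_triangle_ineq[of ?w "block_sum a j t - ?w"] by simp
  ultimately show ?thesis
    using diff by linarith
qed

lemma sum_dyadic_blocks:
  "(\<Sum>n\<le>2 ^ j. phase t n * a n) = (\<Sum>n\<le>1. phase t n * a n) + (\<Sum>i<j. block_sum a i t)"
proof (induction j)
  case 0
  show ?case by (simp only: power_0 lessThan_0 sum.empty add_0_right)
next
  case (Suc j)
  have "{..2 ^ Suc j} = {..2 ^ j} \<union> dyadic_block j"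
    by (auto simp: dyadic_block_def)
  then have "(\<Sum>n\<le>2 ^ Suc j. phase t n * a n) = (\<Sum>n\<le>2 ^ j. phase t n * a n) + block_sum a j t"
    unfolding block_sum_def
    by (simp only:) (subst sum.union_disjoint; auto simp: dyadic_block_def)
  then show ?case
    by (simp only: Suc.IH sum.lessThan_Suc add.assoc)
qed

text \<open>
A finite series has bounded terms, so the previous bound applies to all blocks. It is summable in \<open>j\<close>,
and at each time it holds for all but finitely many \<open>j\<close>. On the interval from -1 to 1 it holds for all
\<open>j\<close>, and the Weierstrass test yields uniform convergence there.
\<close>

lemma dyadic_limit_continuous_at_0:
  assumes q: "0 < q" "q < 1" and fin: "(\<Sum>j. ennreal (block_gauge q a j)) < \<top>"
  defines "A \<equiv> \<lambda>j t. \<Sum>n\<le>2 ^ j. phase t n * a n"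
  shows "convergent (\<lambda>j. A j t)" "((\<lambda>t. lim (\<lambda>j. A j t)) \<longlongrightarrow> lim (\<lambda>j. A j 0)) (at 0)"
proof -
  obtain S where S: "1 \<le> S" "\<And>j. block_gauge q a j \<le> S"
  proof -
    from fin obtain r where r: "0 \<le> r" "(\<Sum>j. ennreal (block_gauge q a j)) = ennreal r"
      by (cases "\<Sum>j. ennreal (block_gauge q a j)") auto
    have "ennreal (block_gauge q a j) \<le> ennreal r" for j
      unfolding r(2)[symmetric] using sum_le_suminf[of "\<lambda>j. ennreal (block_gauge q a j)" "{j}"] by simp
    then have "block_gauge q a j \<le> r" for j
      using r(1) by simp
    then show ?thesis
      by (intro that[of "max 1 r"]) (auto simp: le_max_iff_disj)
  qed
  define m where "m j = 2 * (ln S + 8) * (real (Suc j) * q ^ j) + S * (1 / 2) ^ j" for j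
  have m: "summable m"
    unfolding m_def
  proof (intro summable_add summable_mult)
    show "summable (\<lambda>j. real (Suc j) * q ^ j)"
      using geometric_deriv_sums[of q] q by (auto simp: sums_iff)
    show "summable (\<lambda>j. (1 / 2 :: real) ^ j)"
      by (rule summable_geometric) simp
  qed
  have bound: "cmod (block_sum a j t) \<le> m j" if "\<bar>t\<bar> \<le> 2 ^ j" for j t
    unfolding m_def using q(1) S that by (intro block_sum_bound)
  have sm: "summable (\<lambda>j. block_sum a j t)" for t
  proof -
    obtain J where J: "\<bar>t\<bar> < 2 ^ J"
      using real_arch_pow[of 2 "\<bar>t\<bar>"] by auto
    have "cmod (block_sum a j t) \<le> m j" if "j \<ge> J" for j
    proof -
      have "(2::real) ^ J \<le> 2 ^ j" using that by (intro power_increasing) auto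
      with J have "\<bar>t\<bar> \<le> 2 ^ j" by linarith
      then show ?thesis by (rule bound)
    qed
    with m show ?thesis by (rule summable_comparison_test')
  qed
  define A0 where "A0 t = (\<Sum>n\<le>1. phase t n * a n)" for t
  define F where "F t = A0 t + (\<Sum>j. block_sum a j t)" for t
  have lim: "(\<lambda>j. A j t) \<longlonglongrightarrow> F t" for t
    unfolding A_def sum_dyadic_blocks F_def A0_def
    by (intro tendsto_add tendsto_const summable_LIMSEQ sm)
  show "convergent (\<lambda>j. A j t)"
    using lim by (auto simp: convergent_def)
  have ph: "continuous_on X (\<lambda>t. phase t n)" for X n
    unfolding phase_def by (intro continuous_intros)
  have "uniform_limit {-1..1} (\<lambda>n t. \<Sum>j<n. block_sum a j t) (\<lambda>t. \<Sum>j. block_sum a j t) sequentially"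
  proof (rule Weierstrass_m_test[OF _ m])
    fix j and t :: real assume "t \<in> {-1..1}"
    then have "\<bar>t\<bar> \<le> 1" by auto
    also have "(1::real) \<le> 2 ^ j" by simp
    finally show "cmod (block_sum a j t) \<le> m j" by (rule bound)
  qed
  then have "continuous_on {-1..1} (\<lambda>t. \<Sum>j. block_sum a j t)"
    by (rule uniform_limit_theorem[rotated])
       (auto simp: block_sum_def intro!: always_eventually continuous_intros ph)
  then have "continuous_on {-1..1} F"
    unfolding F_def A0_def by (intro continuous_intros ph)
  then have "continuous (at 0) F"
    by (rule continuous_on_interior) auto
  then have "(F \<longlongrightarrow> F 0) (at 0)"
    by (simp add: isCont_def)
  moreover have "lim (\<lambda>j. A j t) = F t" for t
    by (rule limI[OF lim])
  ultimately show "((\<lambda>t. lim (\<lambda>j. A j t)) \<longlongrightarrow> lim (\<lambda>j. A j 0)) (at 0)"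
    by simp
qed

section \<open>Random blocks at a fixed point of the sphere\<close>

text \<open>
A bound for the mean, packaged with measurability, nonnegativity of the function and nonnegativity of the
bound. Such bounds are stable under sums and nonnegative multiples without further side conditions.
\<close>

definition mean_le :: "'a measure \<Rightarrow> ('a \<Rightarrow> real) \<Rightarrow> real \<Rightarrow> bool" where
  "mean_le M f B \<longleftrightarrow> f \<in> borel_measurable M \<and> (\<forall>x. 0 \<le> f x) \<and> 0 \<le> B \<and>
     (\<integral>\<^sup>+x. ennreal (f x) \<partial>M) \<le> ennreal B"

lemma mean_le_sum:
  assumes "\<And>i. i \<in> I \<Longrightarrow> mean_le M (f i) (B i)"
  shows "mean_le M (\<lambda>x. \<Sum>i\<in>I. f i x) (\<Sum>i\<in>I. B i)"
proof -
  have "(\<integral>\<^sup>+x. ennreal (\<Sum>i\<in>I. f i x) \<partial>M) = (\<Sum>i\<in>I. \<integral>\<^sup>+x. ennreal (f i x) \<partial>M)"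
    using assms by (subst nn_integral_sum[symmetric]) (auto simp: mean_le_def sum_ennreal)
  also have "\<dots> \<le> (\<Sum>i\<in>I. ennreal (B i))"
    using assms by (intro sum_mono) (auto simp: mean_le_def)
  also have "\<dots> = ennreal (\<Sum>i\<in>I. B i)"
    using assms by (intro sum_ennreal) (auto simp: mean_le_def)
  finally show ?thesis
    using assms by (auto simp: mean_le_def intro!: sum_nonneg borel_measurable_sum)
qed

lemma mean_le_add:
  assumes "mean_le M f B" "mean_le M h C"
  shows "mean_le M (\<lambda>x. f x + h x) (B + C)"
  using mean_le_sum[of UNIV M "\<lambda>i. if i then f else h" "\<lambda>i. if i then B else C"] assms
  by (simp add: UNIV_bool add.commute)

lemma mean_le_cmult:
  assumes "mean_le M f B" "0 \<le> c"
  shows "mean_le M (\<lambda>x. c * f x) (c * B)"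
proof -
  have "(\<integral>\<^sup>+x. ennreal (c * f x) \<partial>M) = ennreal c * (\<integral>\<^sup>+x. ennreal (f x) \<partial>M)"
    using assms by (subst nn_integral_cmult[symmetric]) (auto simp: mean_le_def ennreal_mult)
  also have "\<dots> \<le> ennreal (c * B)"
    using assms by (auto simp: mean_le_def ennreal_mult intro!: mult_left_mono)
  finally show ?thesis
    using assms by (auto simp: mean_le_def)
qed

lemma mean_le_weaken: "mean_le M f B \<Longrightarrow> B \<le> C \<Longrightarrow> mean_le M f C"
  by (auto simp: mean_le_def intro: order_trans ennreal_leI)

lemma mean_le_dominated:
  assumes "mean_le M h B" "f \<in> borel_measurable M" "\<And>x. 0 \<le> f x" "\<And>x. f x \<le> h x"
  shows "mean_le M f B"
proof -
  have "(\<integral>\<^sup>+x. ennreal (f x) \<partial>M) \<le> (\<integral>\<^sup>+x. ennreal (h x) \<partial>M)"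
    using assms(4) by (intro nn_integral_mono ennreal_leI)
  with assms show ?thesis
    by (auto simp: mean_le_def)
qed

lemma mean_le_AE_series_finite:
  assumes "\<And>j. mean_le M (f j) (B j)" "summable B"
  shows "AE x in M. (\<Sum>j. ennreal (f j x)) < \<top>"
proof -
  have f: "f j \<in> borel_measurable M" and B: "0 \<le> B j" for j
    using assms(1) by (auto simp: mean_le_def)
  have "(\<integral>\<^sup>+x. (\<Sum>j. ennreal (f j x)) \<partial>M) = (\<Sum>j. \<integral>\<^sup>+x. ennreal (f j x) \<partial>M)"
    using f by (intro nn_integral_suminf) auto
  also have "\<dots> \<le> (\<Sum>j. ennreal (B j))"
    using assms(1) by (intro suminf_le) (auto simp: mean_le_def)
  also have "\<dots> = ennreal (\<Sum>j. B j)"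
    using B assms(2) by (intro suminf_ennreal2)
  finally have "(\<integral>\<^sup>+x. (\<Sum>j. ennreal (f j x)) \<partial>M) \<noteq> \<infinity>"
    by (auto simp: top_unique)
  then have "AE x in M. (\<Sum>j. ennreal (f j x)) \<noteq> \<infinity>"
    using f by (intro nn_integral_noteq_infinite) auto
  then show ?thesis
    by eventually_elim (simp add: less_top)
qed

lemma Re_borel_measurable: "(Re :: complex \<Rightarrow> real) \<in> borel_measurable borel"
  by (intro borel_measurable_continuous_onI continuous_intros)

lemma exp_block_sum_measurable:
  assumes "\<And>n. (\<lambda>\<omega>. a \<omega> n) \<in> borel_measurable M"
  shows "(\<lambda>\<omega>. exp (Re (\<zeta> * block_sum (a \<omega>) j t) / q ^ j)) \<in> borel_measurable M"
  unfolding block_sum_def using assms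
  by (intro measurable_compose[OF _ borel_measurable_exp] borel_measurable_divide borel_measurable_const
      measurable_compose[OF _ Re_borel_measurable] borel_measurable_times borel_measurable_sum)

lemma block_gauge_measurable:
  assumes "\<And>n. (\<lambda>\<omega>. a \<omega> n) \<in> borel_measurable M"
  shows "(\<lambda>\<omega>. block_gauge q (a \<omega>) j) \<in> borel_measurable M"
  unfolding block_gauge_def using assms
  by (intro borel_measurable_add borel_measurable_divide borel_measurable_sum borel_measurable_times
      borel_measurable_const measurable_compose[OF _ borel_measurable_norm] exp_block_sum_measurable)

lemma card_time_grid_le: "real (card (time_grid j)) \<le> 3 * 2 ^ (7 * j)"
proof -
  have "card (time_grid j) \<le> card {- (2 ^ (7 * j))..2 ^ (7 * j) :: int}"
    unfolding time_grid_def by (rule card_image_le) simp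
  also have "\<dots> = 2 * 2 ^ (7 * j) + 1"
    by (simp add: nat_add_distrib nat_mult_distrib nat_power_eq)
  finally have "real (card (time_grid j)) \<le> real (2 * 2 ^ (7 * j) + 1)"
    by (rule of_nat_mono)
  also have "\<dots> \<le> 3 * 2 ^ (7 * j)"
    by simp
  finally show ?thesis .
qed

lemma card_dyadic_block: "card (dyadic_block j) = 2 ^ j"
  by (simp add: dyadic_block_def)

lemma finite_dyadic_block: "finite (dyadic_block j)"
  by (simp add: dyadic_block_def)

lemma dyadic_blockD:
  assumes "n \<in> dyadic_block j"
  shows "2 ^ j \<le> real n" "real n \<le> 2 * 2 ^ j"
proof -
  have "2 ^ j \<le> n" "n \<le> 2 * 2 ^ j"
    using assms by (auto simp: dyadic_block_def)
  then have "real (2 ^ j) \<le> real n" "real n \<le> real (2 * 2 ^ j)"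
    by (blast intro: of_nat_mono)+
  then show "2 ^ j \<le> real n" "real n \<le> 2 * 2 ^ j" by simp_all
qed

lemma num_orders_dyadic_block:
  assumes "n \<in> dyadic_block j"
  shows "real (2 * n + 1) \<le> 5 * 2 ^ j"
proof -
  have "(1::real) \<le> 2 ^ j" by simp
  then show ?thesis
    using dyadic_blockD(2)[OF assms] unfolding of_nat_add of_nat_mult of_nat_numeral of_nat_1 by linarith
qed

lemma quarter_turns_simps:
  "card quarter_turns = 4" "finite quarter_turns" "\<zeta> \<in> quarter_turns \<Longrightarrow> cmod \<zeta> = 1"
  by (simp_all add: quarter_turns_def complex_eq_iff) (auto simp: cmod_def)

text \<open>
This derives the first absolute moment of a Gaussian from its exponential moments.
\<close>

lemma norm_le_exp_turns: "cmod z \<le> (\<Sum>\<zeta>\<in>quarter_turns. exp (Re (\<zeta> * z)))"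
proof -
  have e: "\<bar>x\<bar> \<le> exp x + exp (- x)" for x :: real
    using exp_ge_add_one_self[of x] exp_ge_add_one_self[of "- x"] exp_gt_zero[of x] exp_gt_zero[of "- x"]
    by linarith
  have "(\<Sum>\<zeta>\<in>quarter_turns. exp (Re (\<zeta> * z))) = exp (Re z) + exp (- Re z) + exp (- Im z) + exp (Im z)"
    by (simp add: quarter_turns_def complex_eq_iff)
  then show ?thesis
    using cmod_le[of z] e[of "Re z"] e[of "Im z"] by linarith
qed

lemma norm_phase: "cmod (phase t n) = 1"
  by (simp add: phase_def)

text \<open>
In units of \<open>q^j\<close> the block at a fixed time is a Gaussian of variance at most \<open>C\<close>, so its exponential
moments are bounded in \<open>j\<close>; this holds at every time, as the phases have modulus 1. For the Lipschitz
constant it suffices to bound each weight \<open>w n k\<close> by \<open>C\<close> and to count: a block has \<open>2^j\<close> degrees, at most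
\<open>5 * 2^j\<close> orders in each, and frequencies of at most \<open>6 * 4^j\<close>. Both parts of the gauge then have mean of
order \<open>2^(-j)\<close>.
\<close>

lemma (in prob_space) AE_block_gauge_finite:
  fixes g :: "nat \<Rightarrow> int \<Rightarrow> 'a \<Rightarrow> complex"
  assumes iid: "iid_std_complex_gaussian M (SIGMA n:UNIV. degree_orders n) (\<lambda>(n, k). g n k)"
    and q: "0 < q" "q < 1" and C: "1 \<le> C"
    and var: "\<And>j. (\<Sum>n\<in>dyadic_block j. \<Sum>k\<in>degree_orders n. (cmod (w n k))\<^sup>2) \<le> C * q ^ (2 * j)"
  shows "AE \<omega> in M. (\<Sum>j. ennreal (block_gauge q (\<lambda>n. \<Sum>k\<in>degree_orders n. w n k * g n k \<omega>) j)) < \<top>"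
proof (rule mean_le_AE_series_finite)
  define a where "a \<omega> n = (\<Sum>k\<in>degree_orders n. w n k * g n k \<omega>)" for \<omega> n
  have rv: "g n k \<in> borel_measurable M" if "k \<in> degree_orders n" for n k
    using iid that unfolding iid_std_complex_gaussian_def indep_vars_def by force
  have am: "(\<lambda>\<omega>. a \<omega> n) \<in> borel_measurable M" for n
    unfolding a_def using rv
    by (intro borel_measurable_sum borel_measurable_times borel_measurable_const)
  have grid: "mean_le M (\<lambda>\<omega>. exp (Re (\<zeta> * block_sum (a \<omega>) j t) / q ^ j)) (exp C)"
    if "\<zeta> \<in> quarter_turns" for \<zeta> t j
  proof -
    define J where "J = (SIGMA n:dyadic_block j. degree_orders n)"
    define v where "v = (\<lambda>(n, k). \<zeta> * phase t n * w n k / of_real (q ^ j))"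
    have J: "finite J" "J \<subseteq> (SIGMA n:UNIV. degree_orders n)"
      by (auto simp: J_def finite_dyadic_block finite_degree_orders)
    have sumJ: "(\<Sum>i\<in>J. f i) = (\<Sum>n\<in>dyadic_block j. \<Sum>k\<in>degree_orders n. f (n, k))"
      for f :: "nat \<times> int \<Rightarrow> 'z::comm_monoid_add"
      unfolding J_def by (subst sum.Sigma) (auto simp: finite_dyadic_block finite_degree_orders)
    have eq: "Re (\<Sum>i\<in>J. v i * (case i of (n, k) \<Rightarrow> g n k) \<omega>) = Re (\<zeta> * block_sum (a \<omega>) j t) / q ^ j" for \<omega>
    proof -
      have "(\<Sum>i\<in>J. v i * (case i of (n, k) \<Rightarrow> g n k) \<omega>) = \<zeta> * block_sum (a \<omega>) j t / of_real (q ^ j)"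
        unfolding sumJ v_def block_sum_def a_def sum_distrib_left sum_divide_distrib prod.case
        by (intro sum.cong refl) (simp add: mult_ac)
      then show ?thesis
        by (simp only: Re_divide_of_real)
    qed
    have "(\<Sum>i\<in>J. (cmod (v i))\<^sup>2) = (\<Sum>n\<in>dyadic_block j. \<Sum>k\<in>degree_orders n. (cmod (w n k))\<^sup>2) / q ^ (2 * j)"
      unfolding sumJ v_def sum_divide_distrib prod.case
      using q quarter_turns_simps(3)[OF that]
      by (intro sum.cong refl)
         (simp add: norm_mult norm_divide norm_power norm_phase power_divide power_mult[symmetric] mult.commute)
    also have "\<dots> \<le> C"
      using var[of j] q by (simp add: divide_le_eq)
    finally have "(\<Sum>i\<in>J. (cmod (v i))\<^sup>2) / 4 \<le> C"
      using C by linarith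
    then have "(\<integral>\<^sup>+\<omega>. ennreal (exp (Re (\<zeta> * block_sum (a \<omega>) j t) / q ^ j)) \<partial>M) \<le> ennreal (exp C)"
      unfolding nn_integral_exp_iid_std_complex_gaussian[OF iid J, of v, unfolded eq]
      by (intro ennreal_leI) simp
    then show ?thesis
      using exp_block_sum_measurable[of a, OF am] by (auto simp: mean_le_def)
  qed
  (* 4 * exp 1 comes from four exponential moments, each at most exp 1 *)
  have norm_g: "mean_le M (\<lambda>\<omega>. cmod (g n k \<omega>)) (4 * exp 1)" if k: "k \<in> degree_orders n" for n k
  proof (rule mean_le_dominated)
    show "mean_le M (\<lambda>\<omega>. \<Sum>\<zeta>\<in>quarter_turns. exp (Re (\<zeta> * g n k \<omega>))) (4 * exp 1)"
    proof -
      have "mean_le M (\<lambda>\<omega>. exp (Re (\<zeta> * g n k \<omega>))) (exp 1)" if \<zeta>: "\<zeta> \<in> quarter_turns" for \<zeta>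
      proof -
        have "(\<integral>\<^sup>+\<omega>. ennreal (exp (Re (\<zeta> * g n k \<omega>))) \<partial>M) = ennreal (exp (1 / 4))"
          using nn_integral_exp_iid_std_complex_gaussian[OF iid, of "{(n, k)}" "\<lambda>_. \<zeta>"] k
            quarter_turns_simps(3)[OF \<zeta>] by (simp del: times_complex.sel)
        also have "\<dots> \<le> ennreal (exp 1)"
          by (intro ennreal_leI) simp
        finally have "(\<integral>\<^sup>+\<omega>. ennreal (exp (Re (\<zeta> * g n k \<omega>))) \<partial>M) \<le> ennreal (exp 1)" .
        moreover have "(\<lambda>\<omega>. exp (Re (\<zeta> * g n k \<omega>))) \<in> borel_measurable M"
          using rv[OF k]
          by (intro measurable_compose[OF _ borel_measurable_exp] borel_measurable_const measurable_compose[OF _ Re_borel_measurable]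
              borel_measurable_times)
        ultimately show ?thesis
          by (auto simp: mean_le_def)
      qed
      then have "mean_le M (\<lambda>\<omega>. \<Sum>\<zeta>\<in>quarter_turns. exp (Re (\<zeta> * g n k \<omega>))) (\<Sum>\<zeta>\<in>quarter_turns. exp 1)"
        by (rule mean_le_sum)
      then show ?thesis by (simp only: sum_constant quarter_turns_simps of_nat_numeral)
    qed
    show "(\<lambda>\<omega>. cmod (g n k \<omega>)) \<in> borel_measurable M"
      using rv[OF k] by (rule measurable_compose[OF _ borel_measurable_norm])
  qed (simp, rule norm_le_exp_turns)
  have w_le: "cmod (w n k) \<le> C" if "n \<in> dyadic_block j" "k \<in> degree_orders n" for n k j
  proof -
    have "(cmod (w n k))\<^sup>2 \<le> (\<Sum>k\<in>degree_orders n. (cmod (w n k))\<^sup>2)"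
      using that by (intro member_le_sum) (auto simp: finite_degree_orders)
    also have "\<dots> \<le> (\<Sum>n\<in>dyadic_block j. \<Sum>k\<in>degree_orders n. (cmod (w n k))\<^sup>2)"
      using that by (intro member_le_sum[of n]) (auto simp: finite_dyadic_block intro!: sum_nonneg)
    also have "\<dots> \<le> C * q ^ (2 * j)" by (rule var)
    also have "\<dots> \<le> C * C"
      using q C power_le_one[of q "2 * j"] by (intro mult_left_mono) auto
    finally have "(cmod (w n k))\<^sup>2 \<le> C\<^sup>2" by (simp add: power2_eq_square)
    then show ?thesis
      by (rule power2_le_imp_le) (use C in simp)
  qed
  have lip: "mean_le M (\<lambda>\<omega>. \<Sum>n\<in>dyadic_block j. real n * (real n + 1) * cmod (a \<omega> n))
      (120 * C * exp 1 * 2 ^ (4 * j))" for j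
  proof (rule mean_le_dominated)
    let ?c = "6 * 2 ^ (2 * j) * C"
    show "mean_le M (\<lambda>\<omega>. \<Sum>n\<in>dyadic_block j. \<Sum>k\<in>degree_orders n. ?c * cmod (g n k \<omega>))
        (120 * C * exp 1 * 2 ^ (4 * j))"
    proof (rule mean_le_weaken)
      show "mean_le M (\<lambda>\<omega>. \<Sum>n\<in>dyadic_block j. \<Sum>k\<in>degree_orders n. ?c * cmod (g n k \<omega>))
        (\<Sum>n\<in>dyadic_block j. \<Sum>k\<in>degree_orders n. ?c * (4 * exp 1))"
        using C by (intro mean_le_sum mean_le_cmult norm_g) auto
      have "(\<Sum>n\<in>dyadic_block j. \<Sum>k\<in>degree_orders n. ?c * (4 * exp 1)) =
          (\<Sum>n\<in>dyadic_block j. real (2 * n + 1) * (?c * (4 * exp 1)))"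
        by (simp only: sum_constant card_degree_orders)
      also have "\<dots> \<le> (\<Sum>n\<in>dyadic_block j. (5 * 2 ^ j) * (?c * (4 * exp 1)))"
        using C by (intro sum_mono mult_right_mono num_orders_dyadic_block) auto
      also have "\<dots> = 120 * C * exp 1 * (2 ^ j * 2 ^ j * 2 ^ (2 * j))"
        by (simp add: card_dyadic_block)
      also have "(2::real) ^ j * 2 ^ j * 2 ^ (2 * j) = 2 ^ (4 * j)"
        by (simp add: power_add[symmetric])
      finally show "(\<Sum>n\<in>dyadic_block j. \<Sum>k\<in>degree_orders n. ?c * (4 * exp 1)) \<le>
         120 * C * exp 1 * 2 ^ (4 * j)" .
    qed
    show "(\<lambda>\<omega>. \<Sum>n\<in>dyadic_block j. real n * (real n + 1) * cmod (a \<omega> n)) \<in> borel_measurable M"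
      by (intro borel_measurable_sum borel_measurable_times borel_measurable_const
          measurable_compose[OF _ borel_measurable_norm] am)
    fix \<omega>
    show "0 \<le> (\<Sum>n\<in>dyadic_block j. real n * (real n + 1) * cmod (a \<omega> n))"
      by (intro sum_nonneg) auto
    show "(\<Sum>n\<in>dyadic_block j. real n * (real n + 1) * cmod (a \<omega> n)) \<le>
       (\<Sum>n\<in>dyadic_block j. \<Sum>k\<in>degree_orders n. ?c * cmod (g n k \<omega>))"
    proof (rule sum_mono)
      fix n assume n: "n \<in> dyadic_block j"
      have "(1::real) \<le> 2 ^ j" by simp
      then have "real n + 1 \<le> 3 * 2 ^ j"
        using dyadic_blockD(2)[OF n] by linarith
      then have "real n * (real n + 1) \<le> (2 * 2 ^ j) * (3 * 2 ^ j)"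
        using dyadic_blockD(2)[OF n] by (intro mult_mono) auto
      also have "\<dots> = 6 * (2 ^ j * 2 ^ j)"
        by simp
      also have "(2::real) ^ j * 2 ^ j = 2 ^ (2 * j)"
        by (simp only: mult_2 power_add)
      finally have \<theta>: "real n * (real n + 1) \<le> 6 * 2 ^ (2 * j)" .
      have "cmod (a \<omega> n) \<le> (\<Sum>k\<in>degree_orders n. C * cmod (g n k \<omega>))"
        unfolding a_def using w_le[OF n]
        by (intro sum_norm_le) (auto simp: norm_mult intro!: mult_right_mono)
      with \<theta> have "real n * (real n + 1) * cmod (a \<omega> n) \<le> 6 * 2 ^ (2 * j) * (\<Sum>k\<in>degree_orders n. C * cmod (g n k \<omega>))"
        by (rule mult_mono) auto
      then show "real n * (real n + 1) * cmod (a \<omega> n) \<le> (\<Sum>k\<in>degree_orders n. ?c * cmod (g n k \<omega>))"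
        by (simp add: sum_distrib_left mult.assoc)
    qed
  qed
  show "mean_le M (\<lambda>\<omega>. block_gauge q (\<lambda>n. \<Sum>k\<in>degree_orders n. w n k * g n k \<omega>) j)
      ((12 * exp C + 120 * C * exp 1) * (1 / 2) ^ j)" for j
  proof -
    have 1: "mean_le M (\<lambda>\<omega>. 1 / 2 ^ (8 * j) *
        (\<Sum>t\<in>time_grid j. \<Sum>\<zeta>\<in>quarter_turns. exp (Re (\<zeta> * block_sum (a \<omega>) j t) / q ^ j)))
        (1 / 2 ^ (8 * j) * (\<Sum>t\<in>time_grid j. \<Sum>\<zeta>\<in>quarter_turns. exp C))"
      by (intro mean_le_cmult mean_le_sum grid) auto
    have 2: "mean_le M (\<lambda>\<omega>. 1 / 2 ^ (5 * j) * (\<Sum>n\<in>dyadic_block j. real n * (real n + 1) * cmod (a \<omega> n)))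
        (1 / 2 ^ (5 * j) * (120 * C * exp 1 * 2 ^ (4 * j)))"
      by (intro mean_le_cmult lip) auto
    have "1 / 2 ^ (8 * j) * (\<Sum>t\<in>time_grid j. \<Sum>\<zeta>\<in>quarter_turns. exp C) =
        1 / 2 ^ (8 * j) * (real (card (time_grid j)) * (4 * exp C))"
      by (simp only: sum_constant quarter_turns_simps of_nat_numeral)
    also have "\<dots> \<le> 1 / 2 ^ (8 * j) * (3 * 2 ^ (7 * j) * (4 * exp C))"
      by (intro mult_left_mono mult_right_mono card_time_grid_le) auto
    also have "\<dots> = 12 * exp C * (1 / 2) ^ j"
    proof -
      have "(2::real) ^ (8 * j) = 2 ^ (7 * j) * 2 ^ j"
        by (simp add: power_add[symmetric])
      then show ?thesis by (simp add: power_one_over)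
    qed
    finally have "1 / 2 ^ (8 * j) * (\<Sum>t\<in>time_grid j. \<Sum>\<zeta>\<in>quarter_turns. exp C) \<le> 12 * exp C * (1 / 2) ^ j" .
    moreover have "1 / 2 ^ (5 * j) * (120 * C * exp 1 * 2 ^ (4 * j)) = 120 * C * exp 1 * (1 / 2) ^ j"
    proof -
      have "(2::real) ^ (5 * j) = 2 ^ (4 * j) * 2 ^ j"
        by (simp add: power_add[symmetric])
      then show ?thesis by (simp add: power_one_over)
    qed
    ultimately have "mean_le M (\<lambda>\<omega>. 1 / 2 ^ (8 * j) *
        (\<Sum>t\<in>time_grid j. \<Sum>\<zeta>\<in>quarter_turns. exp (Re (\<zeta> * block_sum (a \<omega>) j t) / q ^ j)) +
        1 / 2 ^ (5 * j) * (\<Sum>n\<in>dyadic_block j. real n * (real n + 1) * cmod (a \<omega> n)))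
      ((12 * exp C + 120 * C * exp 1) * (1 / 2) ^ j)"
      by (intro mean_le_weaken[OF mean_le_add[OF 1 2]]) (simp add: distrib_right)
    moreover have "(\<lambda>n. \<Sum>k\<in>degree_orders n. w n k * g n k \<omega>) = a \<omega>" for \<omega>
      by (simp add: a_def fun_eq_iff)
    ultimately show ?thesis
      by (simp add: block_gauge_def del: times_complex.sel)
  qed
  show "summable (\<lambda>j. (12 * exp C + 120 * C * exp 1) * (1 / 2) ^ j)"
    by (intro summable_mult summable_geometric) simp
qed

section \<open>Almost sure continuity at time zero\<close>

lemma mean_le_basis_square:
  assumes b: "\<And>n. orthonormal_basis (degree_orders n) (b n) (harmonics n)" and k: "k \<in> degree_orders n"
  shows "mean_le area (\<lambda>x. (cmod (b n k x))\<^sup>2) 1"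
proof -
  have bs: "b n k \<in> smooth_S2"
    using basis_harmonic[of b, OF b k] by (rule harmonics_smooth)
  have eq: "b n k x * cnj (b n k x) = complex_of_real ((cmod (b n k x))\<^sup>2)" for x
    by (simp add: complex_norm_square[symmetric])
  have "integrable area (\<lambda>x. b n k x * cnj (b n k x))"
    by (intro integrable_area_product smooth_S2_cnj bs)
  then have int: "integrable area (\<lambda>x. (cmod (b n k x))\<^sup>2)"
    unfolding eq by (simp only: complex_of_real_integrable_eq)
  have "(\<integral>x. b n k x * cnj (b n k x) \<partial>area) = 1"
    using basis_orthonormal[of b, OF b k k] by simp
  then have "complex_of_real (\<integral>x. (cmod (b n k x))\<^sup>2 \<partial>area) = 1"
    unfolding eq by (simp only: integral_complex_of_real)
  then have "(\<integral>x. (cmod (b n k x))\<^sup>2 \<partial>area) = 1"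
    by (simp only: of_real_eq_1_iff)
  then have "(\<integral>\<^sup>+x. ennreal ((cmod (b n k x))\<^sup>2) \<partial>area) = ennreal 1"
    using int by (subst nn_integral_eq_integral) auto
  then show ?thesis
    using int by (auto simp: mean_le_def)
qed

text \<open>
The mean of the block variance over the sphere is of order \<open>q^(4j)\<close>. Dividing by \<open>q^(2j)\<close> leaves a summable
sequence of means, so the sum of the quotients is finite almost everywhere and bounds each of them.
\<close>

lemma AE_block_variance_bound:
  fixes \<alpha> :: real
  assumes b: "\<And>n. orthonormal_basis (degree_orders n) (b n) (harmonics n)" and "\<alpha> > 1"
  defines "q \<equiv> 2 powr ((1 - \<alpha>) / 2)"
  shows "AE x in area. \<exists>C\<ge>1. \<forall>j. (\<Sum>n\<in>dyadic_block j. \<Sum>k\<in>degree_orders n.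
    (cmod (complex_of_real (1 / freq n powr \<alpha>) * b n k x))\<^sup>2) \<le> C * q ^ (2 * j)"
proof -
  have q: "0 < q" "q < 1"
    using \<open>\<alpha> > 1\<close> by (auto simp: q_def powr_less_one)
  define V where "V j x = (\<Sum>n\<in>dyadic_block j. \<Sum>k\<in>degree_orders n.
     (1 / freq n powr \<alpha>)\<^sup>2 * (cmod (b n k x))\<^sup>2)" for j x
  have V_eq: "(\<Sum>n\<in>dyadic_block j. \<Sum>k\<in>degree_orders n.
    (cmod (complex_of_real (1 / freq n powr \<alpha>) * b n k x))\<^sup>2) = V j x" for j x
    unfolding V_def by (simp only: norm_mult norm_of_real power_mult_distrib power2_abs)
  have meanV: "mean_le area (V j) (5 * q ^ (4 * j))" for j
  proof (rule mean_le_weaken)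
    show "mean_le area (V j) (\<Sum>n\<in>dyadic_block j. \<Sum>k\<in>degree_orders n. (1 / freq n powr \<alpha>)\<^sup>2 * 1)"
      unfolding V_def by (intro mean_le_sum mean_le_cmult mean_le_basis_square b) auto
    let ?c = "(1 / (2 ^ j) powr \<alpha>)\<^sup>2 :: real"
    have "(\<Sum>n\<in>dyadic_block j. \<Sum>k\<in>degree_orders n. (1 / freq n powr \<alpha>)\<^sup>2 * 1) =
        (\<Sum>n\<in>dyadic_block j. real (2 * n + 1) * (1 / freq n powr \<alpha>)\<^sup>2)"
      by (simp only: sum_constant card_degree_orders mult_1_right)
    also have "\<dots> \<le> (\<Sum>n\<in>dyadic_block j. (5 * 2 ^ j) * ?c)"
    proof (intro sum_mono mult_mono num_orders_dyadic_block)
      fix n assume n: "n \<in> dyadic_block j"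
      have "2 ^ j \<le> real n" using dyadic_blockD(1)[OF n] .
      also have "real n \<le> freq n"
        unfolding freq_def by (intro real_le_rsqrt) simp
      finally have "(2 ^ j) powr \<alpha> \<le> freq n powr \<alpha>"
        using \<open>\<alpha> > 1\<close> by (intro powr_mono2) auto
      then show "(1 / freq n powr \<alpha>)\<^sup>2 \<le> ?c"
        by (intro power_mono divide_left_mono mult_pos_pos) auto
    qed auto
    also have "\<dots> = 5 * (2 ^ j / (2 ^ j) powr \<alpha>)\<^sup>2"
      by (simp add: card_dyadic_block power2_eq_square)
    also have "2 ^ j / (2 ^ j) powr \<alpha> = q ^ (2 * j)"
    proof -
      have "(2::real) ^ j / (2 ^ j) powr \<alpha> = 2 powr (real j * (1 - \<alpha>))"
        by (simp add: powr_realpow[symmetric] powr_powr powr_diff[symmetric] algebra_simps)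
      also have "\<dots> = q powr real (2 * j)"
        unfolding q_def powr_powr by (simp add: mult.commute)
      also have "\<dots> = q ^ (2 * j)"
        using q by (intro powr_realpow)
      finally show ?thesis .
    qed
    also have "(q ^ (2 * j))\<^sup>2 = q ^ (4 * j)"
      by (simp add: power_mult[symmetric])
    finally show "(\<Sum>n\<in>dyadic_block j. \<Sum>k\<in>degree_orders n. (1 / freq n powr \<alpha>)\<^sup>2 * 1) \<le> 5 * q ^ (4 * j)" .
  qed
  have "AE x in area. (\<Sum>j. ennreal (1 / q ^ (2 * j) * V j x)) < \<top>"
  proof (rule mean_le_AE_series_finite)
    show "mean_le area (\<lambda>x. 1 / q ^ (2 * j) * V j x) (1 / q ^ (2 * j) * (5 * q ^ (4 * j)))" for j
      using q by (intro mean_le_cmult meanV) auto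
    have "1 / q ^ (2 * j) * (5 * q ^ (4 * j)) = 5 * (q\<^sup>2) ^ j" for j
    proof -
      have "q ^ (4 * j) = q ^ (2 * j) * q ^ (2 * j)"
        by (simp add: power_add[symmetric])
      then show ?thesis
        using q by (simp add: power_mult)
    qed
    moreover have "summable (\<lambda>j. 5 * (q\<^sup>2) ^ j)"
      using q by (intro summable_mult summable_geometric) (simp add: power_less_one_iff)
    ultimately show "summable (\<lambda>j. 1 / q ^ (2 * j) * (5 * q ^ (4 * j)))"
      by simp
  qed
  then show ?thesis
  proof eventually_elim
    case (elim x)
    then obtain r where r: "0 \<le> r" "(\<Sum>j. ennreal (1 / q ^ (2 * j) * V j x)) = ennreal r"
      by (cases "\<Sum>j. ennreal (1 / q ^ (2 * j) * V j x)") auto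
    have "V j x \<le> max 1 r * q ^ (2 * j)" for j
    proof -
      have "ennreal (1 / q ^ (2 * j) * V j x) \<le> ennreal r"
        unfolding r(2)[symmetric]
        using sum_le_suminf[of "\<lambda>j. ennreal (1 / q ^ (2 * j) * V j x)" "{j}"] by simp
      then have "1 / q ^ (2 * j) * V j x \<le> max 1 r"
        using r(1) by (simp add: le_max_iff_disj)
      then show ?thesis
        using q by (simp add: divide_le_eq)
    qed
    then show ?case
      unfolding V_eq by (intro exI[of _ "max 1 r"]) auto
  qed
qed

theorem theorem1p2:
  fixes \<alpha> :: real
    and b :: "nat \<Rightarrow> int \<Rightarrow> real^3 \<Rightarrow> complex"
    and P :: "'w measure"
    and g :: "nat \<Rightarrow> int \<Rightarrow> 'w \<Rightarrow> complex"
  assumes "\<alpha> > 1"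
    and "\<And>n. orthonormal_basis (degree_orders n) (b n) (harmonics n)"
    and "prob_space P"
    and "iid_std_complex_gaussian P (SIGMA n:UNIV. degree_orders n) (\<lambda>(n, k). g n k)"
  shows "AE \<phi> in gaussian_law \<alpha> b P g. AE x in area.
           (\<forall>t. schrodinger_defined t \<phi> x) \<and>
           ((\<lambda>t. schrodinger t \<phi> x) \<longlongrightarrow> schrodinger 0 \<phi> x) (at 0)"
proof -
  note b = assms(2) and iid = assms(4)
  interpret P: prob_space P by fact
  interpret A: prob_space area by (rule prob_space_area)
  have rv: "g n k \<in> borel_measurable P" if "k \<in> degree_orders n" for n k
    using iid that unfolding iid_std_complex_gaussian_def P.indep_vars_def by force
  have rs: "random_series \<alpha> b g \<in> measurable P distributions_S2"
    using b rv by (rule random_series_measurable)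
  define L where "L = gaussian_law \<alpha> b P g"
  interpret L: prob_space L
    unfolding L_def gaussian_law_def using rs by (rule P.prob_space_distr)
  interpret AL: pair_prob_space area L ..
  have sL: "sets L = sets distributions_S2" "space L = space distributions_S2"
    by (simp_all add: L_def gaussian_law_def)
  define q :: real where "q = 2 powr ((1 - \<alpha>) / 2)"
  have q: "0 < q" "q < 1"
    using \<open>\<alpha> > 1\<close> by (auto simp: q_def powr_less_one)
  (* c \<phi> x n is the value at x of the projection of \<phi> to degree n, written so that its joint
     measurability is apparent; for nonlinear \<phi> the projection itself need not have this form *)
  define c where "c \<phi> x n = (\<Sum>k\<in>degree_orders n. \<phi> (\<lambda>y. cnj (b n k y)) * b n k x)" for \<phi> x n
  define G where "G \<phi> x = (\<Sum>j. ennreal (block_gauge q (c \<phi> x) j))" for \<phi> x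
  have eval: "(\<lambda>\<phi>. \<phi> (\<lambda>y. cnj (b n k y))) \<in> borel_measurable L" if "k \<in> degree_orders n" for n k
  proof -
    have "(\<lambda>y. cnj (b n k y)) \<in> test_functions"
      using that by (intro harmonics_test_functions[OF harmonics_cnj[OF basis_harmonic[of b, OF b]]])
    then have "(\<lambda>\<phi>. \<phi> (\<lambda>y. cnj (b n k y))) \<in> borel_measurable distributions_S2"
      unfolding distributions_S2_def
      by (intro measurable_restrict_space1 measurable_component_singleton)
    then show ?thesis
      by (subst measurable_cong_sets[OF sL(1) refl])
  qed
  have bm: "b n k \<in> borel_measurable area" if "k \<in> degree_orders n" for n k
    using that basis_harmonic[of b, OF b]
    by (intro borel_measurable_area smooth_S2_measurable harmonics_smooth)
  have G_meas: "(\<lambda>p. G (snd p) (fst p)) \<in> borel_measurable (area \<Otimes>\<^sub>M L)"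
    unfolding G_def
  proof (intro borel_measurable_suminf_order measurable_compose[OF block_gauge_measurable measurable_ennreal])
    show "(\<lambda>p. c (snd p) (fst p) n) \<in> borel_measurable (area \<Otimes>\<^sub>M L)" for n
      unfolding c_def
      by (intro borel_measurable_sum borel_measurable_times measurable_compose[OF measurable_snd eval]
          measurable_compose[OF measurable_fst bm])
  qed
  have "AE x in area. AE \<phi> in L. G \<phi> x < \<top>"
    using AE_block_variance_bound[OF b \<open>\<alpha> > 1\<close>] AE_space
  proof eventually_elim
    case (elim x)
    then obtain C where C: "1 \<le> C" and var: "\<And>j. (\<Sum>n\<in>dyadic_block j. \<Sum>k\<in>degree_orders n.
        (cmod (complex_of_real (1 / freq n powr \<alpha>) * b n k x))\<^sup>2) \<le> C * q ^ (2 * j)"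
      unfolding q_def by blast
    have "(\<lambda>\<phi>. G \<phi> x) \<in> borel_measurable L"
      using measurable_compose[OF measurable_Pair1'[OF elim(2)] G_meas] by simp
    then have "{\<phi> \<in> space distributions_S2. G \<phi> x < \<top>} \<in> sets distributions_S2"
      using borel_measurable_less[of "\<lambda>\<phi>. G \<phi> x" L "\<lambda>_. \<top>"] by (simp add: sL)
    moreover have "AE \<omega> in P. G (random_series \<alpha> b g \<omega>) x < \<top>"
    proof -
      have "c (random_series \<alpha> b g \<omega>) x =
          (\<lambda>n. \<Sum>k\<in>degree_orders n. (complex_of_real (1 / freq n powr \<alpha>) * b n k x) * g n k \<omega>)" for \<omega>
        unfolding c_def
        by (intro ext sum.cong refl) (simp add: random_series_coefficient[of b, OF b] mult_ac)
      then show ?thesis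
        unfolding G_def using P.AE_block_gauge_finite[OF iid q C var] by simp
    qed
    ultimately show ?case
      unfolding L_def gaussian_law_def by (subst AE_distr_iff[OF rs])
  qed
  moreover have "{p \<in> space (area \<Otimes>\<^sub>M L). G (snd p) (fst p) < \<top>} \<in> sets (area \<Otimes>\<^sub>M L)"
    using G_meas by (rule borel_measurable_less) simp
  ultimately have "AE \<phi> in L. AE x in area. G \<phi> x < \<top>"
    by (subst AL.AE_commute[symmetric])
  then have "AE \<phi> in L. AE x in area. (\<forall>t. schrodinger_defined t \<phi> x) \<and>
           ((\<lambda>t. schrodinger t \<phi> x) \<longlongrightarrow> schrodinger 0 \<phi> x) (at 0)"
    using AE_space
  proof eventually_elim
    case (elim \<phi>)
    have "linear_functional \<phi>"
      using elim(2) by (simp add: sL distributions_S2_def space_restrict_space)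
    then have trunc: "schrodinger_trunc N t \<phi> x = (\<Sum>n\<le>N. phase t n * c \<phi> x n)" for N t x
      unfolding schrodinger_trunc_def phase_def c_def by (simp only: harmonic_proj_eq[OF b])
    from elim(1) show ?case
    proof eventually_elim
      case (elim x)
      then show ?case
        unfolding G_def schrodinger_defined_def schrodinger_def trunc
        using dyadic_limit_continuous_at_0[OF q, of "c \<phi> x"] by blast
    qed
  qed
  then show ?thesis
    unfolding L_def .
qed

end
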